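(* Let $\mathcal{H},\mathcal{K}$ be finite-dimensional Hilbert spaces with $\dim(\mathcal{K})\ge\dim(\mathcal{H})$, let $\rho,\sigma$ be density matrices on $\mathcal{H}$, let $r>1$ be real, and let $k:=S(\rho\|\sigma)$. Let $|\psi\rangle$ be a purification of $\rho$ in $\mathcal{H}\otimes\mathcal{K}$. Then there exist pure states $|\phi\rangle,|\theta\rangle\in\mathcal{H}\otimes\mathcal{K}$ and $|\zeta\rangle\in\mathcal{H}\otimes\mathcal{K}\otimes\mathbb{C}^2$ (depending on $r$) such that $|\zeta\rangle$ is a purification of $\sigma$, $\| |\psi\rangle\langle\psi|-|\phi\rangle\langle\phi| \|_{\mathrm{tr}}\le 2/\sqrt{r}$, and \[ |\zeta\rangle=\sqrt{\frac{r-1}{r2^{rk'}}}\,|\phi\rangle|1\rangle+\sqrt{1-\frac{r-1}{r2^{rk'}}}\,|\theta\rangle|0\rangle,\qquad k':=k+4\sqrt{k+2}+2\log(k+2)+5 . \]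
   Context: Relative entropy: $S(\rho\|\sigma):=\mathrm{Tr}\,\rho(\log\rho-\log\sigma)$; all logarithms are to base 2. Trace distance: $\|\rho-\sigma\|_{\mathrm{tr}}:=\mathrm{Tr}\sqrt{(\rho-\sigma)^2}$. A purification of a density matrix $\sigma$ on $\mathcal{H}$ is a pure state on $\mathcal{H}\otimes\mathcal{L}$ whose partial trace over $\mathcal{L}$ equals $\sigma$. *)

theory Defs
  imports "Jordan_Normal_Form.Schur_Decomposition" "HOL-Library.Extended_Real"
begin

text \<open>Finite-dimensional Hilbert spaces are modelled as coordinate spaces C^n; operators
are complex square matrices, vectors are complex column vectors. The tensor product
C^n (x) C^m is C^(n*m) with basis index i*m+j (Kronecker convention).\<close>

definition mtrace :: "complex mat \<Rightarrow> complex" where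
  "mtrace A = (\<Sum>i<dim_row A. A $$ (i,i))"

definition hermitian_mat :: "complex mat \<Rightarrow> bool" where
  "hermitian_mat A \<longleftrightarrow> dim_row A = dim_col A \<and> mat_adjoint A = A"

definition unitary_mat :: "nat \<Rightarrow> complex mat \<Rightarrow> bool" where
  "unitary_mat n U \<longleftrightarrow> U \<in> carrier_mat n n \<and> mat_adjoint U * U = 1\<^sub>m n"

definition psd_mat :: "complex mat \<Rightarrow> bool" where
  "psd_mat A \<longleftrightarrow> hermitian_mat A \<and>
     (\<forall>v \<in> carrier_vec (dim_row A). Re ((A *\<^sub>v v) \<bullet>c v) \<ge> 0)"

definition density_mat :: "nat \<Rightarrow> complex mat \<Rightarrow> bool" where
  "density_mat n \<rho> \<longleftrightarrow> \<rho> \<in> carrier_mat n n \<and> psd_mat \<rho> \<and> mtrace \<rho> = 1"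

definition pure_state :: "nat \<Rightarrow> complex vec \<Rightarrow> bool" where
  "pure_state d v \<longleftrightarrow> v \<in> carrier_vec d \<and> v \<bullet>c v = 1"

definition proj :: "complex vec \<Rightarrow> complex mat" where
  "proj v = mat (dim_vec v) (dim_vec v) (\<lambda>(i,j). v $ i * cnj (v $ j))"

definition vec_kron :: "complex vec \<Rightarrow> complex vec \<Rightarrow> complex vec" where
  "vec_kron v w = vec (dim_vec v * dim_vec w) (\<lambda>i. v $ (i div dim_vec w) * w $ (i mod dim_vec w))"

definition ptrace2 :: "nat \<Rightarrow> nat \<Rightarrow> complex mat \<Rightarrow> complex mat" where
  "ptrace2 n m A = mat n n (\<lambda>(i,j). \<Sum>k<m. A $$ (i*m+k, j*m+k))"

definition purification :: "nat \<Rightarrow> nat \<Rightarrow> complex mat \<Rightarrow> complex vec \<Rightarrow> bool" where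
  "purification n m \<sigma> v \<longleftrightarrow> pure_state (n*m) v \<and> ptrace2 n m (proj v) = \<sigma>"

text \<open>Functional calculus for Hermitian matrices via a unitary diagonalisation
A = U diag(l) U^*, f(A) = U diag(f l) U^* (independent of the chosen diagonalisation).\<close>
definition mat_fun :: "(real \<Rightarrow> real) \<Rightarrow> complex mat \<Rightarrow> complex mat" where
  "mat_fun f A = (let n = dim_row A;
      p = (SOME p. unitary_mat n (fst p) \<and>
             A = fst p * mat_diag n (\<lambda>i. complex_of_real (snd p i)) * mat_adjoint (fst p))
    in fst p * mat_diag n (\<lambda>i. complex_of_real (f (snd p i))) * mat_adjoint (fst p))"

definition trace_norm :: "complex mat \<Rightarrow> real" where
  "trace_norm A = Re (mtrace (mat_fun sqrt (A * A)))"

definition log2_supp :: "real \<Rightarrow> real" where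
  "log2_supp x = (if x > 0 then log 2 x else 0)"

text \<open>Relative entropy S(rho||sigma) = Tr rho (log rho - log sigma), with the standard
convention that it is +infinity when supp rho is not contained in supp sigma
(equivalently, ker sigma is not contained in ker rho).\<close>
definition rel_entropy :: "complex mat \<Rightarrow> complex mat \<Rightarrow> ereal" where
  "rel_entropy \<rho> \<sigma> =
    (if \<forall>v \<in> carrier_vec (dim_row \<sigma>). \<sigma> *\<^sub>v v = 0\<^sub>v (dim_row \<sigma>) \<longrightarrow> \<rho> *\<^sub>v v = 0\<^sub>v (dim_row \<rho>)
     then ereal (Re (mtrace (\<rho> * (mat_fun log2_supp \<rho> - mat_fun log2_supp \<sigma>))))
     else \<infinity>)"

definition kprime :: "real \<Rightarrow> real" where
  "kprime k = k + 4 * sqrt (k + 2) + 2 * log 2 (k + 2) + 5"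

text \<open>The coefficient (r-1)/(r 2^(r k')); when k = +infinity this is read as its limit 0.\<close>
definition zeta_coeff :: "real \<Rightarrow> ereal \<Rightarrow> real" where
  "zeta_coeff r k = (case k of ereal x \<Rightarrow> (r - 1) / (r * 2 powr (r * kprime x)) | _ \<Rightarrow> 0)"

end

theory Submission
  imports Defs "HOL-Analysis.Function_Topology" "HOL-Analysis.L2_Norm" "Jordan_Normal_Form.Spectral_Radius"
begin

text \<open>Put \<open>L = 2 powr (r * kprime k)\<close> and minimise \<open>L Tr \<sigma> Z + Tr \<rho> (1 + Z)\<^sup>-\<^sup>1\<close> over
  \<open>Z \<ge> 0\<close>. With \<open>G = (1 + Z)\<^sup>-\<^sup>1\<close> at the minimum, the first-order condition in rank-one directions is
  \<open>G \<rho> G \<le> L \<sigma>\<close>, so \<open>\<phi>\<close> can be taken to be \<open>(G \<otimes> 1) \<psi>\<close>, normalised. Let \<open>p\<close> and \<open>q\<close> be the diagonals of \<open>\<rho>\<close>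
  and \<open>\<sigma>\<close> in an eigenbasis of \<open>Z\<close>. Minimality in each eigenvalue forces \<open>G\<close> to act as the identity on
  the eigenvectors with \<open>0 < p i \<le> L q i\<close>. By Markov's inequality those carry mass at least \<open>1 - 1/r\<close>,
  because the relative entropy of \<open>p\<close> to \<open>q\<close> is at most \<open>k\<close>; hence the squared overlap of \<open>\<psi>\<close> and \<open>\<phi>\<close> is at
  least \<open>1 - 1/r\<close>. Finally \<open>\<theta>\<close> purifies the normalised remainder of \<open>\<sigma>\<close>.\<close>

subsection \<open>Adjoints, traces and unitaries\<close>

text \<open>For commuting states with positive eigenvalues p and q the minimiser is explicit:
  \<open>Z\<close> has eigenvalues max 0 (sqrt (p / (L q)) - 1) and \<open>G \<rho> G\<close> has
  eigenvalues min p (L q), so the surplus of p over L q is cut off. The variational problem extends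
  this truncation to states without a common eigenbasis. It also selects the basis in which the
  classical estimate is made, hence the need for monotonicity of relative entropy under that
  measurement. A minimum exists although \<open>Z\<close> ranges over an unbounded set: finite
  relative entropy gives \<open>\<rho> \<le> M \<sigma>\<close>, and eigenvalues above M / L never
  help. Normalisation costs nothing: with N = Tr \<open>\<rho> G G\<close> and a = Tr
  \<open>\<rho> G\<close> the squared overlap is a a / N, and \<open>G \<le> 1\<close> gives N \<le>
  a, so it is at least N. Dividing \<open>G \<rho> G\<close> by N \<ge> 1 - 1/r is offset by the
  factor (r - 1) / r of the coefficient. The trace distance of pure states, 2 sqrt (1 - squared
  overlap), then gives 2 / sqrt r.\<close>

abbreviation adj :: "complex mat \<Rightarrow> complex mat" where "adj \<equiv> mat_adjoint"

lemma adj_dim [simp]: "dim_row (adj A) = dim_col A" "dim_col (adj A) = dim_row A"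
  unfolding mat_adjoint_def by auto

lemma adj_carrier [simp]: "A \<in> carrier_mat n m \<Longrightarrow> adj A \<in> carrier_mat m n"
  by (intro carrier_matI) auto

lemma adj_index [simp]:
  "i < dim_col A \<Longrightarrow> j < dim_row A \<Longrightarrow> adj A $$ (i,j) = cnj (A $$ (j,i))"
  unfolding mat_adjoint_def by (simp add: mat_of_rows_index)

lemma adj_adj [simp]: "adj (adj A) = A"
  by (rule eq_matI) auto

lemma mult_carrier_square [simp]:
  "A \<in> carrier_mat n n \<Longrightarrow> B \<in> carrier_mat n n \<Longrightarrow> A * B \<in> carrier_mat n n"
  by auto

lemma mult_index:
  assumes "A \<in> carrier_mat n m" "B \<in> carrier_mat m l" "i < n" "j < l"
  shows "(A * B) $$ (i,j) = (\<Sum>k<m. A $$ (i,k) * B $$ (k,j))"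
  using assms by (auto simp: scalar_prod_def lessThan_atLeast0 intro!: sum.cong)

lemma adj_mult:
  assumes "A \<in> carrier_mat n m" "B \<in> carrier_mat m l"
  shows "adj (A * B) = adj B * adj A"
proof (rule eq_matI)
  fix i j assume "i < dim_row (adj B * adj A)" "j < dim_col (adj B * adj A)"
  then have i: "i < l" and j: "j < n" using assms by auto
  have "adj (A * B) $$ (i,j) = cnj ((A * B) $$ (j,i))" using i j assms by simp
  also have "\<dots> = (\<Sum>k<m. cnj (A $$ (j,k)) * cnj (B $$ (k,i)))"
    by (simp add: mult_index[OF assms j i] del: index_mult_mat)
  also have "\<dots> = (\<Sum>k<m. adj B $$ (i,k) * adj A $$ (k,j))"
    using assms i j by (intro sum.cong) auto
  also have "\<dots> = (adj B * adj A) $$ (i,j)"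
    using mult_index[OF adj_carrier[OF assms(2)] adj_carrier[OF assms(1)] i j] by simp
  finally show "adj (A * B) $$ (i,j) = (adj B * adj A) $$ (i,j)" .
qed (use assms in auto)

lemma mult_vec_index:
  assumes "A \<in> carrier_mat n m" "v \<in> carrier_vec m" "i < n"
  shows "(A *\<^sub>v v) $ i = (\<Sum>k<m. A $$ (i,k) * v $ k)"
  using assms by (auto simp: scalar_prod_def lessThan_atLeast0 intro!: sum.cong)

lemma cinner_sum:
  assumes "w \<in> carrier_vec n"
  shows "v \<bullet>c w = (\<Sum>k<n. v $ k * cnj (w $ k))"
  using assms by (auto simp: scalar_prod_def lessThan_atLeast0 intro!: sum.cong)

lemma cinner_self:
  assumes "v \<in> carrier_vec n"
  shows "v \<bullet>c v = complex_of_real (\<Sum>k<n. (cmod (v $ k))\<^sup>2)"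
  unfolding of_real_sum complex_norm_square by (simp add: cinner_sum[OF assms])

lemma cinner_commute:
  assumes "v \<in> carrier_vec n" "w \<in> carrier_vec n"
  shows "v \<bullet>c w = cnj (w \<bullet>c v)"
  by (simp add: cinner_sum[OF assms(1)] cinner_sum[OF assms(2)] mult.commute)

lemma cinner_adj:
  assumes A: "A \<in> carrier_mat n m" and v: "v \<in> carrier_vec m" and w: "w \<in> carrier_vec n"
  shows "(A *\<^sub>v v) \<bullet>c w = v \<bullet>c (adj A *\<^sub>v w)"
proof -
  have "(A *\<^sub>v v) \<bullet>c w = (\<Sum>i<n. \<Sum>k<m. A $$ (i,k) * v $ k * cnj (w $ i))"
    unfolding cinner_sum[OF w]
    by (intro sum.cong refl) (simp add: mult_vec_index[OF A v] sum_distrib_right del: index_mult_mat_vec)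
  also have "\<dots> = (\<Sum>k<m. \<Sum>i<n. v $ k * cnj (adj A $$ (k,i) * w $ i))"
    using A by (subst sum.swap) (auto intro!: sum.cong)
  also have "\<dots> = v \<bullet>c (adj A *\<^sub>v w)"
    unfolding cinner_sum[OF mult_mat_vec_carrier[OF adj_carrier[OF A] w]]
    by (intro sum.cong refl)
      (simp add: mult_vec_index[OF adj_carrier[OF A] w] sum_distrib_left del: index_mult_mat_vec)
  finally show ?thesis .
qed

lemma mtrace_sum: "A \<in> carrier_mat n n \<Longrightarrow> mtrace A = (\<Sum>i<n. A $$ (i,i))"
  by (auto simp: mtrace_def)

lemma mtrace_mult:
  assumes "A \<in> carrier_mat n m" "B \<in> carrier_mat m n"
  shows "mtrace (A * B) = (\<Sum>i<n. \<Sum>k<m. A $$ (i,k) * B $$ (k,i))"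
  unfolding mtrace_sum[OF mult_carrier_mat[OF assms]]
  by (intro sum.cong refl mult_index[OF assms]) auto

lemma mtrace_comm:
  assumes "A \<in> carrier_mat n m" "B \<in> carrier_mat m n"
  shows "mtrace (A * B) = mtrace (B * A)"
  unfolding mtrace_mult[OF assms] mtrace_mult[OF assms(2,1)]
  by (subst sum.swap) (simp add: mult.commute)

lemma mtrace_add:
  "A \<in> carrier_mat n n \<Longrightarrow> B \<in> carrier_mat n n \<Longrightarrow> mtrace (A + B) = mtrace A + mtrace B"
  by (auto simp: mtrace_def sum.distrib)

lemma mtrace_minus:
  "A \<in> carrier_mat n n \<Longrightarrow> B \<in> carrier_mat n n \<Longrightarrow> mtrace (A - B) = mtrace A - mtrace B"
  by (auto simp: mtrace_def sum_subtractf)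

lemma mtrace_smult:
  "A \<in> carrier_mat n n \<Longrightarrow> mtrace (c \<cdot>\<^sub>m A) = c * mtrace A"
  by (auto simp: mtrace_def sum_distrib_left)

lemma unitary_carrier: "unitary_mat n U \<Longrightarrow> U \<in> carrier_mat n n"
  by (simp add: unitary_mat_def)

lemma unitary_left: "unitary_mat n U \<Longrightarrow> adj U * U = 1\<^sub>m n"
  by (simp add: unitary_mat_def)

lemma unitary_right: "unitary_mat n U \<Longrightarrow> U * adj U = 1\<^sub>m n"
  using mat_mult_left_right_inverse[of "adj U" n U] by (simp add: unitary_mat_def)

lemma unitary_cancel:
  assumes U: "unitary_mat n U" and X: "X \<in> carrier_mat n m"
  shows "adj U * (U * X) = X" "U * (adj U * X) = X"
proof -
  note c = unitary_carrier[OF U]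
  have "adj U * (U * X) = adj U * U * X"
    using assoc_mult_mat[OF adj_carrier[OF c] c X] by simp
  then show "adj U * (U * X) = X" using X by (simp add: unitary_left[OF U])
  have "U * (adj U * X) = U * adj U * X"
    using assoc_mult_mat[OF c adj_carrier[OF c] X] by simp
  then show "U * (adj U * X) = X" using X by (simp add: unitary_right[OF U])
qed

lemma unitary_mult: "unitary_mat n U \<Longrightarrow> unitary_mat n V \<Longrightarrow> unitary_mat n (U * V)"
proof -
  assume U: "unitary_mat n U" and V: "unitary_mat n V"
  note c = unitary_carrier[OF U] unitary_carrier[OF V]
  have "adj (U * V) * (U * V) = adj V * (adj U * (U * V))"
    using c by (simp add: adj_mult[OF c] assoc_mult_mat[of _ n n _ n _ n])
  also have "\<dots> = 1\<^sub>m n" using c by (simp add: unitary_cancel[OF U] unitary_left[OF V])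
  finally show ?thesis using c by (simp add: unitary_mat_def)
qed

subsection \<open>The spectral theorem\<close>

definition spectral :: "nat \<Rightarrow> complex mat \<Rightarrow> (nat \<Rightarrow> real) \<Rightarrow> complex mat" where
  "spectral n U f = U * mat_diag n (\<lambda>i. complex_of_real (f i)) * adj U"

lemma unitary_extension:
  assumes v: "v \<in> carrier_vec n" and v1: "v \<bullet>c v = 1"
  obtains W where "unitary_mat n W" "col W 0 = v"
proof -
  interpret cof_vec_space n "TYPE(complex)" .
  have v0: "v \<noteq> 0\<^sub>v n" using v1 by auto
  define b where "b = basis_completion v"
  define ws where "ws = gram_schmidt n b"
  from basis_completion[OF v v0, folded b_def]
  have dist_b: "distinct b" and indep: "\<not> lin_dep (set b)" and b: "set b \<subseteq> carrier_vec n" 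
    and hdb: "hd b = v" and len_b: "length b = n" by auto
  have n: "n > 0" using v v0 by (cases n) auto
  from hdb len_b n obtain vs where bv: "b = v # vs" by (cases b, auto)
  from gram_schmidt_result[OF b dist_b indep refl, folded ws_def]
  have ws: "set ws \<subseteq> carrier_vec n" "corthogonal ws" "length ws = n" 
    by (auto simp: len_b)
  from gram_schmidt_hd[OF v, of vs, folded bv] have hdws: "hd ws = v" unfolding ws_def .
  then have ws0: "ws ! 0 = v" using ws n by (cases ws) auto
  \<comment> \<open>Gram-Schmidt yields orthogonal columns of arbitrary length, so each is scaled by
    its inverse norm. Column 0 is \<open>v\<close> itself, whose scale is 1 because \<open>v\<close>
    is a unit vector.\<close>
  define c where "c i = complex_of_real (1 / sqrt (Re (ws ! i \<bullet>c ws ! i)))" for i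
  define W where "W = mat n n (\<lambda>(a,i). c i * (ws ! i) $ a)"
  have W: "W \<in> carrier_mat n n" by (simp add: W_def)
  have wsc: "ws ! i \<in> carrier_vec n" if "i < n" for i using ws that by auto
  have ip: "(adj W * W) $$ (i,j) = cnj (c i) * c j * (ws ! j \<bullet>c ws ! i)" if "i < n" "j < n" for i j
    using that W wsc
    by (subst mult_index[OF adj_carrier[OF W] W])
      (auto simp: W_def cinner_sum[OF wsc] sum_distrib_left intro!: sum.cong)
  have "(adj W * W) $$ (i,j) = (if i = j then 1 else 0)" if ij: "i < n" "j < n" for i j
  proof (cases "i = j")
    case False
    then have "ws ! j \<bullet>c ws ! i = 0" using corthogonalD[OF ws(2), of j i] ij ws by auto
    then show ?thesis using ip[OF ij] False by simp
  next
    case True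
    obtain x where eq: "ws ! i \<bullet>c ws ! i = complex_of_real x" and x0: "x \<ge> 0"
      using cinner_self[OF wsc[OF ij(1)]] by (metis (no_types, lifting) sum_nonneg zero_le_power2)
    have "ws ! i \<bullet>c ws ! i \<noteq> 0" using corthogonalD[OF ws(2), of i i] ij ws by auto
    then have pos: "x > 0" using eq x0 by auto
    have "cnj (c i) * c i * (ws ! i \<bullet>c ws ! i) = complex_of_real ((1 / sqrt x) * (1 / sqrt x) * x)"
      unfolding c_def eq by (simp only: complex_cnj_complex_of_real of_real_mult Re_complex_of_real)
    also have "(1 / sqrt x) * (1 / sqrt x) * x = 1" using pos by (simp add: field_simps)
    finally show ?thesis using ip[OF ij] True by simp
  qed
  then have "adj W * W = 1\<^sub>m n" using W by (intro eq_matI) auto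
  then have "unitary_mat n W" using W by (simp add: unitary_mat_def)
  moreover have "col W 0 = v"
  proof (rule eq_vecI)
    show "dim_vec (col W 0) = dim_vec v" using W v by simp
    fix a assume "a < dim_vec v"
    then show "col W 0 $ a = v $ a" using n v v1 by (simp add: W_def c_def ws0)
  qed
  ultimately show thesis by (rule that)
qed

text \<open>Deflation: a unit eigenvector is completed to a unitary \<open>W\<close>. In that basis
  the first column is \<open>e\<close> followed by zeros, and Hermiticity forces the same on the
  first row, so a Hermitian block of size \<open>n\<close> is left for the induction
  hypothesis.\<close>

lemma spectral_theorem:
  assumes "A \<in> carrier_mat n n" "adj A = A"
  obtains U l where "unitary_mat n U" "A = spectral n U l"
proof -
  have "\<exists>U l. unitary_mat n U \<and> A = spectral n U l"
    using assms
  proof (induction n arbitrary: A)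
    case 0
    then have "unitary_mat 0 (1\<^sub>m 0)" "A = spectral 0 (1\<^sub>m 0) (\<lambda>_. 0)"
      by (auto simp: unitary_mat_def spectral_def)
    then show ?case by blast
  next
    case (Suc n A)
    let ?N = "Suc n"
    have "spectrum A \<noteq> {}" using spectrum_non_empty[OF Suc.prems(1)] by simp
    then obtain e where "eigenvalue A e" unfolding spectrum_def by auto
    then obtain u where u: "u \<in> carrier_vec ?N" "u \<noteq> 0\<^sub>v ?N" "A *\<^sub>v u = e \<cdot>\<^sub>v u"
      using Suc.prems unfolding eigenvalue_def eigenvector_def by auto
    have u0: "u \<bullet>c u \<noteq> 0" using u(1,2) by simp
    obtain x where eq: "u \<bullet>c u = complex_of_real x" and x0: "x \<ge> 0"
      using cinner_self[OF u(1)] by (metis (no_types, lifting) sum_nonneg zero_le_power2)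
    have pos: "x > 0" using u0 eq x0 by auto
    define c where "c = complex_of_real (1 / sqrt x)"
    define v where "v = c \<cdot>\<^sub>v u"
    have v: "v \<in> carrier_vec ?N" using u by (simp add: v_def)
    have "v \<bullet>c v = c * cnj c * (u \<bullet>c u)"
      unfolding cinner_sum[OF v] cinner_sum[OF u(1)] sum_distrib_left
      using u(1) by (intro sum.cong) (auto simp: v_def)
    also have "\<dots> = complex_of_real ((1 / sqrt x) * (1 / sqrt x) * x)"
      unfolding c_def eq by (simp only: complex_cnj_complex_of_real of_real_mult Re_complex_of_real)
    also have "(1 / sqrt x) * (1 / sqrt x) * x = 1" using pos by (simp add: field_simps)
    finally have v1: "v \<bullet>c v = 1" by simp
    have Av: "A *\<^sub>v v = e \<cdot>\<^sub>v v"
      using u Suc.prems by (simp add: v_def mult_mat_vec smult_smult_assoc mult.commute)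
    obtain W where W: "unitary_mat ?N W" "col W 0 = v" using unitary_extension[OF v v1] .
    note Wc = unitary_carrier[OF W(1)]
    define B where "B = adj W * A * W"
    have Bc: "B \<in> carrier_mat ?N ?N" using Wc Suc.prems by (simp add: B_def)
    have adjB: "adj B = B"
      using Wc Suc.prems(1) unfolding B_def
      by (simp add: adj_mult[of _ ?N ?N _ ?N] Suc.prems(2) assoc_mult_mat[of _ ?N ?N _ ?N _ ?N])
    have B0: "B $$ (i,0) = (if i = 0 then e else 0)" if "i < ?N" for i
    proof -
      have "B = adj W * (A * W)"
        unfolding B_def by (rule assoc_mult_mat[OF adj_carrier[OF Wc] Suc.prems(1) Wc])
      then have "B $$ (i,0) = (\<Sum>k<?N. adj W $$ (i,k) * (A * W) $$ (k,0))"
        using mult_index[OF adj_carrier[OF Wc] mult_carrier_mat[OF Suc.prems(1) Wc] that, of 0] by simp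
      also have "\<dots> = (\<Sum>k<?N. adj W $$ (i,k) * (e * W $$ (k,0)))"
      proof (intro sum.cong refl)
        fix k assume k: "k \<in> {..<?N}"
        have "(A * W) $$ (k,0) = (\<Sum>j<?N. A $$ (k,j) * W $$ (j,0))"
          using k by (intro mult_index[OF Suc.prems(1) Wc]) auto
        also have "\<dots> = (\<Sum>j<?N. A $$ (k,j) * v $ j)"
          unfolding W(2)[symmetric] using Wc by (intro sum.cong) auto
        also have "\<dots> = (A *\<^sub>v v) $ k"
          using mult_vec_index[OF Suc.prems(1) v, of k] k by simp
        also have "\<dots> = e * W $$ (k,0)" unfolding Av unfolding W(2)[symmetric] using k Wc by auto
        finally show "adj W $$ (i,k) * (A * W) $$ (k,0) = adj W $$ (i,k) * (e * W $$ (k,0))" by simp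
      qed
      also have "\<dots> = e * (adj W * W) $$ (i,0)"
        unfolding mult_index[OF adj_carrier[OF Wc] Wc that zero_less_Suc] sum_distrib_left
        by (intro sum.cong) auto
      also have "\<dots> = (if i = 0 then e else 0)" using that by (simp add: unitary_left[OF W(1)])
      finally show ?thesis .
    qed
    have B0': "B $$ (0,i) = (if i = 0 then e else 0)" if "i < ?N" for i
    proof -
      have *: "B $$ (0,i) = cnj (B $$ (i,0))" using adj_index[of 0 B i] that Bc adjB by auto
      have e: "cnj e = e" using adj_index[of 0 B 0] Bc adjB B0[of 0] by auto
      show ?thesis using * B0[OF that] e by simp
    qed
    \<comment> \<open>A diagonal entry of a Hermitian matrix is its own conjugate; this is what lets
      \<open>l'\<close> be real valued.\<close>
    have er: "complex_of_real (Re e) = e"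
      using adj_index[of 0 B 0] Bc adjB B0[of 0] by (auto simp: complex_eq_iff)
    define C where "C = mat n n (\<lambda>(i,j). B $$ (Suc i, Suc j))"
    have Cc: "C \<in> carrier_mat n n" by (simp add: C_def)
    have "adj C = C"
    proof (rule eq_matI)
      fix i j assume "i < dim_row C" "j < dim_col C"
      then have ij: "i < n" "j < n" using Cc by auto
      have "cnj (B $$ (Suc j, Suc i)) = B $$ (Suc i, Suc j)"
        using adj_index[of "Suc i" B "Suc j"] Bc ij unfolding adjB by auto
      then show "adj C $$ (i,j) = C $$ (i,j)" using ij by (simp add: C_def)
    qed (use Cc in auto)
    from Suc.IH[OF Cc this] obtain V l where V: "unitary_mat n V" and Cl: "C = spectral n V l" by blast
    note Vc = unitary_carrier[OF V]
    define V' where "V' = four_block_mat (1\<^sub>m 1) (0\<^sub>m 1 n) (0\<^sub>m n 1) V"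
    define l' where "l' = case_nat (Re e) l"
    have V'c: "V' \<in> carrier_mat ?N ?N" using Vc unfolding V'_def by auto
    have adjV': "adj V' = four_block_mat (1\<^sub>m 1) (0\<^sub>m 1 n) (0\<^sub>m n 1) (adj V)"
      by (rule eq_matI) (use Vc in \<open>auto simp: V'_def\<close>)
    have "adj V' * V' = four_block_mat (1\<^sub>m 1) (0\<^sub>m 1 n) (0\<^sub>m n 1) (adj V * V)"
      unfolding adjV' unfolding V'_def
      by (subst mult_four_block_mat[of _ 1 1 _ n _ n _ _ 1 _ n]) (use Vc in auto)
    also have "\<dots> = 1\<^sub>m ?N" unfolding unitary_left[OF V] by (rule eq_matI) auto
    finally have V'u: "unitary_mat ?N V'" using V'c by (simp add: unitary_mat_def)
    have dg: "mat_diag ?N (\<lambda>i. complex_of_real (l' i)) =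
        four_block_mat (mat 1 1 (\<lambda>_. e)) (0\<^sub>m 1 n) (0\<^sub>m n 1) (mat_diag n (\<lambda>i. complex_of_real (l i)))"
      by (rule eq_matI) (auto simp: mat_diag_def l'_def er split: nat.splits)
    define D where "D = mat_diag n (\<lambda>i. complex_of_real (l i))"
    have Dc: "D \<in> carrier_mat n n" by (simp add: D_def)
    have VDc: "V * D \<in> carrier_mat n n" using Vc Dc by simp
    have "V' * mat_diag ?N (\<lambda>i. complex_of_real (l' i)) = four_block_mat (mat 1 1 (\<lambda>_. e)) (0\<^sub>m 1 n) (0\<^sub>m n 1) (V * D)"
      unfolding dg D_def[symmetric] V'_def
      by (subst mult_four_block_mat[of _ 1 1 _ n _ n _ _ 1 _ n])
        (use Vc Dc VDc carrier_matD[OF Dc] carrier_matD[OF VDc] in auto)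
    then have "spectral ?N V' l' = four_block_mat (mat 1 1 (\<lambda>_. e)) (0\<^sub>m 1 n) (0\<^sub>m n 1) (V * D) *
        four_block_mat (1\<^sub>m 1) (0\<^sub>m 1 n) (0\<^sub>m n 1) (adj V)"
      by (simp only: spectral_def adjV')
    also have "\<dots> = four_block_mat (mat 1 1 (\<lambda>_. e)) (0\<^sub>m 1 n) (0\<^sub>m n 1) (V * D * adj V)"
      by (subst mult_four_block_mat[of _ 1 1 _ n _ n _ _ 1 _ n])
        (use Vc Dc VDc carrier_matD[OF Dc] carrier_matD[OF VDc] in auto)
    also have "\<dots> = four_block_mat (mat 1 1 (\<lambda>_. e)) (0\<^sub>m 1 n) (0\<^sub>m n 1) C"
      using Cl by (simp add: spectral_def D_def)
    also have "\<dots> = B"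
    proof (rule eq_matI)
      fix i j assume "i < dim_row B" "j < dim_col B"
      then have ij: "i < ?N" "j < ?N" using Bc by auto
      show "four_block_mat (mat 1 1 (\<lambda>_. e)) (0\<^sub>m 1 n) (0\<^sub>m n 1) C $$ (i,j) = B $$ (i,j)"
        using ij B0[of i] B0'[of j] Cc by (cases i; cases j) (auto simp: C_def)
    qed (use Bc Cc in auto)
    finally have BV: "B = spectral ?N V' l'" by simp
    have "A = W * B * adj W"
      using Suc.prems(1) Wc mult_carrier_mat[OF Suc.prems(1) Wc]
      by (simp add: B_def assoc_mult_mat[of _ ?N ?N _ ?N _ ?N] unitary_right[OF W(1)] unitary_cancel[OF W(1)])
    also have "\<dots> = spectral ?N (W * V') l'"
      unfolding BV spectral_def using Wc V'c mat_diag_dim[of ?N]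
      by (simp add: adj_mult[OF Wc V'c] assoc_mult_mat[of _ ?N ?N _ ?N _ ?N])
    finally show ?case using unitary_mult[OF W(1) V'u] by blast
  qed
  then show thesis using that by blast
qed

subsection \<open>Quadratic forms and functional calculus\<close>

definition qform :: "complex mat \<Rightarrow> complex vec \<Rightarrow> real" where
  "qform A v = Re ((A *\<^sub>v v) \<bullet>c v)"

lemma cinner_mult_sum:
  assumes A: "A \<in> carrier_mat n n" and v: "v \<in> carrier_vec n" and w: "w \<in> carrier_vec n"
  shows "(A *\<^sub>v v) \<bullet>c w = (\<Sum>k<n. \<Sum>l<n. A $$ (k,l) * v $ l * cnj (w $ k))"
  unfolding cinner_sum[OF w]
  by (intro sum.cong refl) (simp add: mult_vec_index[OF A v] sum_distrib_right del: index_mult_mat_vec)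

lemma spectral_carrier [simp]: "U \<in> carrier_mat n n \<Longrightarrow> spectral n U f \<in> carrier_mat n n"
  unfolding spectral_def by simp

lemma spectral_cong: "(\<And>i. i < n \<Longrightarrow> f i = g i) \<Longrightarrow> spectral n U f = spectral n U g"
proof -
  assume "\<And>i. i < n \<Longrightarrow> f i = g i"
  then have "mat_diag n (\<lambda>i. complex_of_real (f i)) = mat_diag n (\<lambda>i. complex_of_real (g i))"
    by (intro eq_matI) (auto simp: mat_diag_def)
  then show ?thesis by (simp only: spectral_def)
qed

lemma spectral_index:
  assumes U: "U \<in> carrier_mat n n" and kl: "k < n" "l < n"
  shows "spectral n U f $$ (k,l) = (\<Sum>i<n. complex_of_real (f i) * U $$ (k,i) * cnj (U $$ (l,i)))"
proof -
  let ?D = "U * mat_diag n (\<lambda>i. complex_of_real (f i))"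
  have D: "?D \<in> carrier_mat n n" using U by simp
  have "?D $$ (k,i) = U $$ (k,i) * complex_of_real (f i)" if "i < n" for i
    using kl that by (simp add: mat_diag_mult_right[OF U])
  then show ?thesis unfolding spectral_def mult_index[OF D adj_carrier[OF U] kl]
    using U kl by (intro sum.cong) auto
qed

lemma spectral_adj [simp]:
  assumes U: "U \<in> carrier_mat n n"
  shows "adj (spectral n U f) = spectral n U f"
proof (rule eq_matI)
  fix i j assume "i < dim_row (spectral n U f)" "j < dim_col (spectral n U f)"
  then have ij: "i < n" "j < n" using spectral_carrier[OF U, of f] by auto
  have "adj (spectral n U f) $$ (i,j) = cnj (spectral n U f $$ (j,i))"
    using spectral_carrier[OF U, of f] ij by (intro adj_index) auto
  also have "\<dots> = spectral n U f $$ (i,j)"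
    unfolding spectral_index[OF U ij] spectral_index[OF U ij(2,1)] by (simp add: mult_ac)
  finally show "adj (spectral n U f) $$ (i,j) = spectral n U f $$ (i,j)" .
qed (use spectral_carrier[OF U, of f] in auto)

lemma spectral_mult:
  assumes U: "unitary_mat n U"
  shows "spectral n U f * spectral n U g = spectral n U (\<lambda>i. f i * g i)"
proof -
  note c = unitary_carrier[OF U]
  define F where "F = mat_diag n (\<lambda>i. complex_of_real (f i))"
  define G where "G = mat_diag n (\<lambda>i. complex_of_real (g i))"
  have FG: "F \<in> carrier_mat n n" "G \<in> carrier_mat n n" by (auto simp: F_def G_def)
  have "spectral n U f * spectral n U g = U * (F * G) * adj U"
    using c FG unfolding spectral_def F_def[symmetric] G_def[symmetric]
    by (simp add: assoc_mult_mat[of _ n n _ n _ n] unitary_cancel[OF U, of _ n])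
  then show ?thesis by (simp add: F_def G_def spectral_def)
qed

lemma spectral_add:
  assumes "U \<in> carrier_mat n n"
  shows "spectral n U f + spectral n U g = spectral n U (\<lambda>i. f i + g i)"
proof (rule eq_matI)
  have d: "dim_row (spectral n U h) = n" "dim_col (spectral n U h) = n" for h
    using spectral_carrier[OF assms, of h] by auto
  show "dim_row (spectral n U f + spectral n U g) = dim_row (spectral n U (\<lambda>i. f i + g i))"
    "dim_col (spectral n U f + spectral n U g) = dim_col (spectral n U (\<lambda>i. f i + g i))"
    by (simp_all add: d)
  fix i j assume "i < dim_row (spectral n U (\<lambda>i. f i + g i))" "j < dim_col (spectral n U (\<lambda>i. f i + g i))"
  then show "(spectral n U f + spectral n U g) $$ (i,j) = spectral n U (\<lambda>i. f i + g i) $$ (i,j)"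
    by (simp add: d spectral_index[OF assms] sum.distrib distrib_right)
qed

lemma spectral_one:
  assumes "unitary_mat n U"
  shows "spectral n U (\<lambda>_. 1) = 1\<^sub>m n"
  using unitary_carrier[OF assms] by (simp add: spectral_def unitary_right[OF assms])

lemma spectral_eigenvector:
  assumes U: "unitary_mat n U" and i: "i < n"
  shows "spectral n U f *\<^sub>v col U i = complex_of_real (f i) \<cdot>\<^sub>v col U i"
proof -
  note c = unitary_carrier[OF U]
  have D: "U * mat_diag n (\<lambda>i. complex_of_real (f i)) \<in> carrier_mat n n" using c by simp
  have "spectral n U f * U = U * mat_diag n (\<lambda>i. complex_of_real (f i)) * (adj U * U)"
    unfolding spectral_def by (rule assoc_mult_mat[OF D adj_carrier[OF c] c])
  also have "\<dots> = mat n n (\<lambda>(k,i). U $$ (k,i) * complex_of_real (f i))"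
    using D c by (simp add: unitary_left[OF U] mat_diag_mult_right[OF c])
  finally have eq: "spectral n U f * U = mat n n (\<lambda>(k,i). U $$ (k,i) * complex_of_real (f i))" .
  have "col (spectral n U f * U) i = spectral n U f *\<^sub>v col U i"
    by (rule col_mult2[OF spectral_carrier[OF c] c i])
  moreover have "col (mat n n (\<lambda>(k,i). U $$ (k,i) * complex_of_real (f i))) i = complex_of_real (f i) \<cdot>\<^sub>v col U i"
    using c i by (intro eq_vecI) auto
  ultimately show ?thesis unfolding eq by simp
qed

lemma unitary_col_cinner:
  assumes U: "unitary_mat n U" and ij: "i < n" "j < n"
  shows "col U j \<bullet>c col U i = (if i = j then 1 else 0)"
proof -
  note c = unitary_carrier[OF U]
  have "col U j \<bullet>c col U i = (adj U * U) $$ (i,j)"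
    unfolding mult_index[OF adj_carrier[OF c] c ij] cinner_sum[OF col_carrier_vec[OF ij(1) c]]
    using c ij by (intro sum.cong) auto
  then show ?thesis using ij by (simp add: unitary_left[OF U])
qed

lemma qform_spectral_col:
  assumes U: "unitary_mat n U" and i: "i < n"
  shows "qform (spectral n U f) (col U i) = f i"
  using unitary_col_cinner[OF U i i] unitary_carrier[OF U] i
  by (simp add: qform_def spectral_eigenvector[OF U i])

lemma qform_spectral:
  assumes U: "U \<in> carrier_mat n n" and v: "v \<in> carrier_vec n"
  shows "qform (spectral n U f) v = (\<Sum>i<n. f i * (cmod (v \<bullet>c col U i))\<^sup>2)"
proof -
  have "(spectral n U f *\<^sub>v v) \<bullet>c v =
      (\<Sum>k<n. \<Sum>l<n. (\<Sum>i<n. complex_of_real (f i) * U $$ (k,i) * cnj (U $$ (l,i))) * v $ l * cnj (v $ k))"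
    unfolding cinner_mult_sum[OF spectral_carrier[OF U] v v]
    by (intro sum.cong refl) (simp add: spectral_index[OF U])
  also have "\<dots> = (\<Sum>k<n. \<Sum>l<n. \<Sum>i<n. complex_of_real (f i) * (v $ l * cnj (U $$ (l,i))) * cnj (v $ k * cnj (U $$ (k,i))))"
    by (simp add: sum_distrib_left sum_distrib_right mult_ac)
  also have "\<dots> = (\<Sum>k<n. \<Sum>i<n. \<Sum>l<n. complex_of_real (f i) * (v $ l * cnj (U $$ (l,i))) * cnj (v $ k * cnj (U $$ (k,i))))"
    by (intro sum.cong refl sum.swap)
  also have "\<dots> = (\<Sum>i<n. \<Sum>k<n. \<Sum>l<n. complex_of_real (f i) * (v $ l * cnj (U $$ (l,i))) * cnj (v $ k * cnj (U $$ (k,i))))"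
    by (rule sum.swap)
  also have "\<dots> = (\<Sum>i<n. complex_of_real (f i) * ((\<Sum>l<n. v $ l * cnj (U $$ (l,i))) * cnj (\<Sum>k<n. v $ k * cnj (U $$ (k,i)))))"
    by (simp add: sum_distrib_left sum_distrib_right mult_ac)
  also have "\<dots> = (\<Sum>i<n. complex_of_real (f i) * ((v \<bullet>c col U i) * cnj (v \<bullet>c col U i)))"
    using U by (intro sum.cong refl) (simp add: cinner_sum[of "col U _" n])
  also have "\<dots> = complex_of_real (\<Sum>i<n. f i * (cmod (v \<bullet>c col U i))\<^sup>2)"
    unfolding of_real_sum of_real_mult complex_norm_square ..
  finally show ?thesis by (simp add: qform_def)
qed

lemma mtrace_mult_spectral:
  assumes A: "A \<in> carrier_mat n n" and U: "U \<in> carrier_mat n n"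
  shows "mtrace (A * spectral n U f) = (\<Sum>i<n. complex_of_real (f i) * ((A *\<^sub>v col U i) \<bullet>c col U i))"
proof -
  have "mtrace (A * spectral n U f) =
      (\<Sum>k<n. \<Sum>l<n. A $$ (k,l) * (\<Sum>i<n. complex_of_real (f i) * U $$ (l,i) * cnj (U $$ (k,i))))"
    unfolding mtrace_mult[OF A spectral_carrier[OF U]]
    by (intro sum.cong refl) (simp add: spectral_index[OF U])
  also have "\<dots> = (\<Sum>k<n. \<Sum>l<n. \<Sum>i<n. complex_of_real (f i) * (A $$ (k,l) * U $$ (l,i) * cnj (U $$ (k,i))))"
    by (simp add: sum_distrib_left mult_ac)
  also have "\<dots> = (\<Sum>k<n. \<Sum>i<n. \<Sum>l<n. complex_of_real (f i) * (A $$ (k,l) * U $$ (l,i) * cnj (U $$ (k,i))))"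
    by (intro sum.cong refl sum.swap)
  also have "\<dots> = (\<Sum>i<n. \<Sum>k<n. \<Sum>l<n. complex_of_real (f i) * (A $$ (k,l) * U $$ (l,i) * cnj (U $$ (k,i))))"
    by (rule sum.swap)
  also have "\<dots> = (\<Sum>i<n. complex_of_real (f i) * ((A *\<^sub>v col U i) \<bullet>c col U i))"
    using U by (intro sum.cong refl) (simp add: cinner_mult_sum[OF A, of "col U _" "col U _"] sum_distrib_left)
  finally show ?thesis .
qed

lemma Re_mtrace_mult_spectral:
  assumes "A \<in> carrier_mat n n" "U \<in> carrier_mat n n"
  shows "Re (mtrace (A * spectral n U f)) = (\<Sum>i<n. f i * qform A (col U i))"
  unfolding mtrace_mult_spectral[OF assms] by (simp add: qform_def)

lemma mtrace_mult_proj: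
  assumes A: "A \<in> carrier_mat n n" and v: "v \<in> carrier_vec n"
  shows "mtrace (A * proj v) = (A *\<^sub>v v) \<bullet>c v"
proof -
  have P: "proj v \<in> carrier_mat n n" using v by (simp add: proj_def)
  show ?thesis unfolding mtrace_mult[OF A P] cinner_mult_sum[OF A v v]
    using v by (intro sum.cong refl) (auto simp: proj_def mult_ac)
qed

lemma psd_matD:
  assumes "psd_mat A" "A \<in> carrier_mat n n"
  shows "adj A = A" "v \<in> carrier_vec n \<Longrightarrow> qform A v \<ge> 0"
  using assms by (auto simp: psd_mat_def hermitian_mat_def qform_def)

lemma psd_spectral:
  assumes "psd_mat A" "A \<in> carrier_mat n n"
  obtains U l where "unitary_mat n U" "A = spectral n U l" "\<And>i. l i \<ge> 0"
proof -
  from spectral_theorem[OF assms(2) psd_matD(1)[OF assms]]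
  obtain U l where U: "unitary_mat n U" and A: "A = spectral n U l" .
  have "l i \<ge> 0" if "i < n" for i
    using qform_spectral_col[OF U that, of l] psd_matD(2)[OF assms, of "col U i"] A that unitary_carrier[OF U]
    by (simp add: col_carrier_vec)
  \<comment> \<open>\<open>l\<close> is arbitrary at indices from \<open>n\<close> on. Absolute
    values leave the matrix unchanged and give the sign condition at every index.\<close>
  then have "A = spectral n U (\<lambda>i. \<bar>l i\<bar>)" unfolding A by (intro spectral_cong) simp
  with U show thesis by (rule that) simp
qed

subsection \<open>The variational problem\<close>

text \<open>The objective at \<open>Z = spectral n U z\<close>; parametrising by eigenbasis and eigenvalues makes
  its continuity evident and avoids matrix inverses.\<close>

definition cost :: "nat \<Rightarrow> complex mat \<Rightarrow> complex mat \<Rightarrow> real \<Rightarrow> complex mat \<Rightarrow> (nat \<Rightarrow> real) \<Rightarrow> real" where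
  "cost n \<rho> \<sigma> L U z = (\<Sum>i<n. L * z i * qform \<sigma> (col U i) + qform \<rho> (col U i) / (1 + z i))"

section \<open>Compactness and existence of a minimiser\<close>

lemma compact_functions:
  assumes "\<And>x. compact (K x)"
  shows "compact {f :: 'a \<Rightarrow> 'b::topological_space. \<forall>x. f x \<in> K x}"
proof -
  \<comment> \<open>Tychonoff: unitaries and eigenvalue lists will both be points of function spaces
    with the product topology.\<close>
  have "compactin (product_topology (\<lambda>_. euclidean) UNIV) (PiE UNIV K)"
    using assms by (simp add: compactin_PiE)
  moreover have "PiE UNIV K = {f. \<forall>x. f x \<in> K x}" by auto
  ultimately show ?thesis by (simp add: euclidean_product_topology)
qed

text \<open>Polynomial equations in the entries, one for each pair of columns, make unitarity a
  closed condition.\<close>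

lemma unitary_mat_iff:
  "unitary_mat n (mat n n f) \<longleftrightarrow>
    (\<forall>i\<in>{..<n}. \<forall>j\<in>{..<n}. (\<Sum>k<n. cnj (f (k,i)) * f (k,j)) = (if i = j then 1 else 0))" (is "?l \<longleftrightarrow> ?r")
proof -
  have c: "mat n n f \<in> carrier_mat n n" by simp
  have e: "(adj (mat n n f) * mat n n f) $$ (i,j) = (\<Sum>k<n. cnj (f (k,i)) * f (k,j))" if "i < n" "j < n" for i j
    unfolding mult_index[OF adj_carrier[OF c] c that] using that by (intro sum.cong) auto
  show ?thesis
  proof
    assume ?l
    then show ?r using e unfolding unitary_mat_def by (auto simp del: index_mult_mat)
  next
    assume r: ?r
    have "adj (mat n n f) * mat n n f = 1\<^sub>m n"
    proof (rule eq_matI)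
      fix i j assume "i < dim_row (1\<^sub>m n :: complex mat)" "j < dim_col (1\<^sub>m n :: complex mat)"
      then show "(adj (mat n n f) * mat n n f) $$ (i,j) = 1\<^sub>m n $$ (i,j)"
        using e[of i j] r by auto
    qed auto
    then show ?l by (simp add: unitary_mat_def)
  qed
qed

text \<open>Every column is a unit vector. The bound places all unitaries in one compact box of
  entries.\<close>

lemma unitary_entry_le:
  assumes U: "unitary_mat n U" and ij: "i < n" "j < n"
  shows "cmod (U $$ (i,j)) \<le> 1"
proof -
  note c = unitary_carrier[OF U]
  have cj: "col U j \<in> carrier_vec n" using c ij by simp
  have "complex_of_real (\<Sum>k<n. (cmod (col U j $ k))\<^sup>2) = 1"
    using cinner_self[OF cj] unitary_col_cinner[OF U ij(2) ij(2)] by simp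
  then have "(\<Sum>k<n. (cmod (col U j $ k))\<^sup>2) = 1" using of_real_eq_1_iff by blast
  moreover have "(cmod (col U j $ i))\<^sup>2 \<le> (\<Sum>k<n. (cmod (col U j $ k))\<^sup>2)"
    using ij by (intro member_le_sum) auto
  ultimately have "(cmod (U $$ (i,j)))\<^sup>2 \<le> 1\<^sup>2" using c ij by simp
  then show ?thesis by (rule power2_le_imp_le) simp
qed

text \<open>The quadratic forms and the denominators \<open>1 + z i\<close>, which are at least 1,
  depend continuously on entries and eigenvalues; with eigenvalues capped by \<open>R\<close> these
  range over a compact set.\<close>

lemma cost_minimizer_bounded:
  fixes R :: real
  assumes \<rho>: "\<rho> \<in> carrier_mat n n" and \<sigma>: "\<sigma> \<in> carrier_mat n n" and R: "R \<ge> 0"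
  obtains U z where "unitary_mat n U" "\<And>i. 0 \<le> z i"
    "\<And>U' z'. unitary_mat n U' \<Longrightarrow> (\<And>i. 0 \<le> z' i \<and> z' i \<le> R) \<Longrightarrow> cost n \<rho> \<sigma> L U z \<le> cost n \<rho> \<sigma> L U' z'"
proof -
  \<comment> \<open>A square around the closed unit disc, built as the continuous image of a real
    square so that it is visibly compact.\<close>
  define Q :: "complex set" where "Q = (\<lambda>x. complex_of_real (fst x) + \<i> * complex_of_real (snd x)) ` ({-1..1} \<times> {-1..1})"
  have "compact Q" unfolding Q_def
    by (intro compact_continuous_image compact_Times compact_Icc continuous_intros)
  have Q: "c \<in> Q" if "cmod c \<le> 1" for c
    unfolding Q_def using that abs_Re_le_cmod[of c] abs_Im_le_cmod[of c]
    by (intro image_eqI[of _ _ "(Re c, Im c)"]) (auto simp: complex_eq)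
  define A :: "(nat \<times> nat \<Rightarrow> complex) set" where "A = {f. \<forall>x. f x \<in> Q}"
  define C :: "(nat \<times> nat \<Rightarrow> complex) set" where "C = {f. unitary_mat n (mat n n f)}"
  define Z :: "(nat \<Rightarrow> real) set" where "Z = {z. \<forall>x. z x \<in> {0..R}}"
  define S where "S = (A \<inter> C) \<times> Z"
  have coord: "continuous_on T (\<lambda>f. f x)" for T :: "(nat \<times> nat \<Rightarrow> complex) set" and x
    by (rule continuous_on_subset[OF continuous_on_product_coordinates]) auto
  have "C = (\<Inter>i\<in>{..<n}. \<Inter>j\<in>{..<n}. {f. (\<Sum>k<n. cnj (f (k,i)) * f (k,j)) = (if i = j then 1 else 0)})"
    unfolding C_def unitary_mat_iff by auto
  then have "closed C"
    by (auto intro!: closed_INT closed_Collect_eq continuous_intros coord)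
  moreover have "compact A" unfolding A_def by (rule compact_functions) fact
  moreover have "compact Z" unfolding Z_def by (rule compact_functions) simp
  ultimately have "compact S" unfolding S_def by (intro compact_Times compact_Int_closed)
  define F where "F = (\<lambda>x::(nat \<times> nat \<Rightarrow> complex) \<times> (nat \<Rightarrow> real).
    \<Sum>i<n. L * snd x i * Re (\<Sum>k<n. \<Sum>l<n. \<sigma> $$ (k,l) * fst x (l,i) * cnj (fst x (k,i))) +
      Re (\<Sum>k<n. \<Sum>l<n. \<rho> $$ (k,l) * fst x (l,i) * cnj (fst x (k,i))) / (1 + snd x i))"
  have F: "cost n \<rho> \<sigma> L (mat n n f) z = F (f, z)" for f z
    unfolding cost_def F_def qform_def
    by (intro sum.cong refl) (simp add: cinner_mult_sum[OF \<rho>] cinner_mult_sum[OF \<sigma>])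
  have c1: "continuous_on S (\<lambda>x. fst x y)" for y
    by (rule continuous_on_product_then_coordinatewise) (intro continuous_intros)
  have c2: "continuous_on S (\<lambda>x. snd x y)" for y
    by (rule continuous_on_product_then_coordinatewise) (intro continuous_intros)
  have "1 + snd x i \<noteq> 0" if "x \<in> S" for x i
    using that unfolding S_def Z_def by (auto simp: mem_Times_iff dest!: spec[of _ i])
  then have "continuous_on S F" unfolding F_def
    by (intro continuous_intros c1 c2) auto
  moreover have "((\<lambda>(i,j). if i = j then 1 else 0), (\<lambda>_. 0)) \<in> S"
    using R by (auto simp: S_def A_def C_def Z_def Q unitary_mat_iff if_distrib cong: if_cong)
  ultimately obtain x where x: "x \<in> S" "\<And>y. y \<in> S \<Longrightarrow> F x \<le> F y"
    using continuous_attains_inf[OF \<open>compact S\<close>, of F] by blast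
  show thesis
  proof (rule that)
    show "unitary_mat n (mat n n (fst x))" using x by (auto simp: S_def C_def)
    show "0 \<le> snd x i" for i using x by (auto simp: S_def Z_def)
    fix U' and z' :: "nat \<Rightarrow> real" assume U': "unitary_mat n U'" and z': "\<And>i. 0 \<le> z' i \<and> z' i \<le> R"
    \<comment> \<open>Zero padding outside the \<open>n\<close> by \<open>n\<close> block puts every
      coordinate in \<open>Q\<close>, as membership in \<open>A\<close> demands.\<close>
    define f where "f = (\<lambda>(i,j). if i < n \<and> j < n then U' $$ (i,j) else 0)"
    have f: "mat n n f = U'"
      by (rule eq_matI) (use unitary_carrier[OF U'] in \<open>auto simp: f_def\<close>)
    have "f y \<in> Q" for y using unitary_entry_le[OF U'] by (auto simp: f_def split: prod.splits intro!: Q)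
    then have "(f, z') \<in> S" using z' U' by (simp add: S_def A_def C_def Z_def f)
    then have "F (fst x, snd x) \<le> F (f, z')" using x by simp
    then show "cost n \<rho> \<sigma> L (mat n n (fst x)) (snd x) \<le> cost n \<rho> \<sigma> L U' z'"
      unfolding F[symmetric] f .
  qed
qed

text \<open>Capping eigenvalues does not raise the cost. With \<open>p \<le> M * q\<close> a summand
  has slope \<open>L * q - p / (1 + z)^2 \<ge> q * (L - M / (1 + z)^2)\<close>, which is nonnegative
  once \<open>z \<ge> M / L\<close>; so a minimum over the capped set is global.\<close>

lemma cost_minimizer:
  assumes \<rho>: "\<rho> \<in> carrier_mat n n" and \<sigma>: "\<sigma> \<in> carrier_mat n n" and L: "L > 0" and M: "M \<ge> 0"
    and le: "\<And>v. v \<in> carrier_vec n \<Longrightarrow> 0 \<le> qform \<rho> v \<and> 0 \<le> qform \<sigma> v \<and> qform \<rho> v \<le> M * qform \<sigma> v"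
  obtains U z where "unitary_mat n U" "\<And>i. 0 \<le> z i"
    "\<And>U' z'. unitary_mat n U' \<Longrightarrow> (\<And>i. i < n \<Longrightarrow> 0 \<le> z' i) \<Longrightarrow> cost n \<rho> \<sigma> L U z \<le> cost n \<rho> \<sigma> L U' z'"
proof -
  define R where "R = M / L"
  have R: "R \<ge> 0" using L M by (simp add: R_def)
  obtain U z where U: "unitary_mat n U" and z: "\<And>i. 0 \<le> z i" and
    min: "\<And>U' z'. unitary_mat n U' \<Longrightarrow> (\<And>i. 0 \<le> z' i \<and> z' i \<le> R) \<Longrightarrow> cost n \<rho> \<sigma> L U z \<le> cost n \<rho> \<sigma> L U' z'"
    by (rule cost_minimizer_bounded[OF \<rho> \<sigma> R, of L]) blast
  show thesis
  proof (rule that[OF U z])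
    fix U' and z' :: "nat \<Rightarrow> real" assume U': "unitary_mat n U'" and z': "\<And>i. i < n \<Longrightarrow> 0 \<le> z' i"
    define y where "y i = (if i < n then min (z' i) R else 0)" for i
    have "cost n \<rho> \<sigma> L U z \<le> cost n \<rho> \<sigma> L U' y"
      using z' R by (intro min[OF U']) (auto simp: y_def)
    also have "\<dots> \<le> cost n \<rho> \<sigma> L U' z'"
      unfolding cost_def
    proof (rule sum_mono)
      fix i assume "i \<in> {..<n}"
      then have i: "i < n" by simp
      define p where "p = qform \<rho> (col U' i)"
      define q where "q = qform \<sigma> (col U' i)"
      have pq: "0 \<le> p" "0 \<le> q" "p \<le> M * q"
        using le[of "col U' i"] unitary_carrier[OF U'] i by (auto simp: p_def q_def)
      have "L * y i * q + p / (1 + y i) \<le> L * z' i * q + p / (1 + z' i)"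
      proof (cases "z' i \<le> R")
        case True then show ?thesis using i by (simp add: y_def)
      next
        case False
        let ?w = "z' i"
        have w: "?w > R" using False by simp
        \<comment> \<open>Finite-difference form of the slope estimate: it compares the values at
          \<open>R\<close> and at \<open>?w\<close> without a derivative.\<close>
        have D: "R \<le> (1 + R) * (1 + ?w)"
          using mult_nonneg_nonneg[OF R, of ?w] R w by (simp add: algebra_simps)
        have "p \<le> L * q * R" using pq L by (simp add: R_def mult.commute)
        also have "\<dots> \<le> L * q * ((1 + R) * (1 + ?w))"
          using D L pq by (intro mult_left_mono) auto
        finally have "p * (?w - R) \<le> L * q * ((1 + R) * (1 + ?w)) * (?w - R)"
          using w by (intro mult_right_mono) auto
        moreover have "0 < (1 + R) * (1 + ?w)" using R w by simp
        ultimately have "p * (?w - R) / ((1 + R) * (1 + ?w)) \<le> L * q * (?w - R)"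
          by (simp add: pos_divide_le_eq mult_ac)
        moreover have "p / (1 + R) - p / (1 + ?w) = p * (?w - R) / ((1 + R) * (1 + ?w))"
          using R w by (simp add: field_simps)
        ultimately have "L * R * q + p / (1 + R) \<le> L * ?w * q + p / (1 + ?w)"
          by (simp add: algebra_simps)
        then show ?thesis using w i by (simp add: y_def)
      qed
      then show "L * y i * qform \<sigma> (col U' i) + qform \<rho> (col U' i) / (1 + y i)
          \<le> L * z' i * qform \<sigma> (col U' i) + qform \<rho> (col U' i) / (1 + z' i)"
        by (simp add: p_def q_def)
    qed
    finally show "cost n \<rho> \<sigma> L U z \<le> cost n \<rho> \<sigma> L U' z'" .
  qed
qed

subsection \<open>First-order conditions\<close>

lemma qform_add:
  assumes "A \<in> carrier_mat n n" "B \<in> carrier_mat n n" "v \<in> carrier_vec n"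
  shows "qform (A + B) v = qform A v + qform B v"
proof -
  have "((A + B) *\<^sub>v v) \<bullet>c v = (A *\<^sub>v v) \<bullet>c v + (B *\<^sub>v v) \<bullet>c v"
    using assms by (simp add: add_mult_distrib_mat_vec[of _ n n] add_scalar_prod_distrib[of _ n])
  then show ?thesis by (simp add: qform_def)
qed

lemma qform_smult:
  assumes A: "A \<in> carrier_mat n n" and v: "v \<in> carrier_vec n"
  shows "qform (complex_of_real c \<cdot>\<^sub>m A) v = c * qform A v"
proof -
  have "(complex_of_real c \<cdot>\<^sub>m A *\<^sub>v v) \<bullet>c v = complex_of_real c * ((A *\<^sub>v v) \<bullet>c v)"
    using A by (simp add: cinner_mult_sum[of _ n, OF _ v v] sum_distrib_left mult_ac)
  then show ?thesis by (simp add: qform_def)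
qed

lemma proj_carrier [simp]: "v \<in> carrier_vec n \<Longrightarrow> proj v \<in> carrier_mat n n"
  by (simp add: proj_def)

lemma proj_adj [simp]: "adj (proj v) = proj v"
  by (rule eq_matI) (auto simp: proj_def)

lemma proj_index: "v \<in> carrier_vec n \<Longrightarrow> i < n \<Longrightarrow> j < n \<Longrightarrow> proj v $$ (i,j) = v $ i * cnj (v $ j)"
  by (auto simp: proj_def)

lemma proj_mult_vec:
  assumes v: "v \<in> carrier_vec n" and w: "w \<in> carrier_vec n"
  shows "proj v *\<^sub>v w = (w \<bullet>c v) \<cdot>\<^sub>v v"
proof (rule eq_vecI)
  fix i assume "i < dim_vec ((w \<bullet>c v) \<cdot>\<^sub>v v)"
  then have i: "i < n" using v by simp
  have "(proj v *\<^sub>v w) $ i = (\<Sum>k<n. v $ i * cnj (v $ k) * w $ k)"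
    unfolding mult_vec_index[OF proj_carrier[OF v] w i]
    using i v by (intro sum.cong) (auto simp: proj_index)
  also have "\<dots> = ((w \<bullet>c v) \<cdot>\<^sub>v v) $ i"
    using i v by (simp add: cinner_sum[OF v] sum_distrib_left sum_distrib_right mult_ac)
  finally show "(proj v *\<^sub>v w) $ i = ((w \<bullet>c v) \<cdot>\<^sub>v v) $ i" .
qed (use carrier_matD[OF proj_carrier[OF v]] v in auto)

lemma qform_proj:
  assumes v: "v \<in> carrier_vec n" and w: "w \<in> carrier_vec n"
  shows "qform (proj v) w = (cmod (w \<bullet>c v))\<^sup>2"
proof -
  have "(proj v *\<^sub>v w) \<bullet>c w = (w \<bullet>c v) * cnj (w \<bullet>c v)"
    unfolding proj_mult_vec[OF v w] using v w cinner_commute[OF v w] by simp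
  then show ?thesis by (simp add: qform_def complex_norm_square[symmetric])
qed

lemma hermitian_cinner_real:
  assumes A: "A \<in> carrier_mat n n" and h: "adj A = A" and v: "v \<in> carrier_vec n"
  shows "(A *\<^sub>v v) \<bullet>c v = complex_of_real (qform A v)"
proof -
  have Av: "A *\<^sub>v v \<in> carrier_vec n" using A v by simp
  have "(A *\<^sub>v v) \<bullet>c v = cnj ((A *\<^sub>v v) \<bullet>c v)"
    using cinner_adj[OF A v v] cinner_commute[OF v Av] h by simp
  then have "Im ((A *\<^sub>v v) \<bullet>c v) = 0" by (metis cnj.simps(2) neg_equal_zero)
  then show ?thesis by (simp add: qform_def complex_eq_iff)
qed

lemma proj_sandwich:
  assumes A: "A \<in> carrier_mat n n" and v: "v \<in> carrier_vec n"
  shows "proj v * (A * proj v) = ((A *\<^sub>v v) \<bullet>c v) \<cdot>\<^sub>m proj v"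
proof (rule eq_matI)
  note P = proj_carrier[OF v]
  have AP: "A * proj v \<in> carrier_mat n n" using A P by simp
  fix i j assume "i < dim_row (((A *\<^sub>v v) \<bullet>c v) \<cdot>\<^sub>m proj v)" "j < dim_col (((A *\<^sub>v v) \<bullet>c v) \<cdot>\<^sub>m proj v)"
  then have ij: "i < n" "j < n" using P by auto
  have "(proj v * (A * proj v)) $$ (i,j) = (\<Sum>k<n. (v $ i * cnj (v $ k)) * (\<Sum>l<n. A $$ (k,l) * (v $ l * cnj (v $ j))))"
    unfolding mult_index[OF P AP ij]
  proof (intro sum.cong refl)
    fix k assume "k \<in> {..<n}"
    then have k: "k < n" by simp
    have "(A * proj v) $$ (k,j) = (\<Sum>l<n. A $$ (k,l) * (v $ l * cnj (v $ j)))"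
      unfolding mult_index[OF A P k ij(2)] using ij v by (intro sum.cong) (auto simp: proj_index)
    then show "proj v $$ (i,k) * (A * proj v) $$ (k,j) = (v $ i * cnj (v $ k)) * (\<Sum>l<n. A $$ (k,l) * (v $ l * cnj (v $ j)))"
      using ij k v by (simp add: proj_index del: index_mult_mat)
  qed
  also have "\<dots> = ((A *\<^sub>v v) \<bullet>c v) * proj v $$ (i,j)"
    using ij v by (simp add: proj_index cinner_mult_sum[OF A v v] sum_distrib_left sum_distrib_right mult_ac)
  finally show "(proj v * (A * proj v)) $$ (i,j) = (((A *\<^sub>v v) \<bullet>c v) \<cdot>\<^sub>m proj v) $$ (i,j)"
    using ij P by simp
qed (use A v in \<open>auto simp: proj_def\<close>)

lemma cost_eq_mtrace:
  assumes "\<rho> \<in> carrier_mat n n" "\<sigma> \<in> carrier_mat n n" "U \<in> carrier_mat n n"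
  shows "cost n \<rho> \<sigma> L U z =
    L * Re (mtrace (\<sigma> * spectral n U z)) + Re (mtrace (\<rho> * spectral n U (\<lambda>i. 1 / (1 + z i))))"
  unfolding Re_mtrace_mult_spectral[OF assms(1,3)] Re_mtrace_mult_spectral[OF assms(2,3)] cost_def
  by (simp add: sum.distrib sum_distrib_left mult_ac)

lemma spectral_plus_one:
  assumes U: "unitary_mat n U"
  shows "1\<^sub>m n + spectral n U z = spectral n U (\<lambda>i. 1 + z i)"
  using spectral_add[OF unitary_carrier[OF U], of "\<lambda>_. 1" z] by (simp add: spectral_one[OF U])

lemma spectral_inverse:
  assumes U: "unitary_mat n U" and z: "\<And>i. z i \<ge> 0"
  shows "(1\<^sub>m n + spectral n U z) * spectral n U (\<lambda>i. 1 / (1 + z i)) = 1\<^sub>m n"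
    "spectral n U (\<lambda>i. 1 / (1 + z i)) * (1\<^sub>m n + spectral n U z) = 1\<^sub>m n"
proof -
  have "1 + z i \<noteq> 0" for i using z[of i] by linarith
  then show "(1\<^sub>m n + spectral n U z) * spectral n U (\<lambda>i. 1 / (1 + z i)) = 1\<^sub>m n"
    "spectral n U (\<lambda>i. 1 / (1 + z i)) * (1\<^sub>m n + spectral n U z) = 1\<^sub>m n"
    unfolding spectral_plus_one[OF U] spectral_mult[OF U] by (simp_all add: spectral_one[OF U])
qed

text \<open>With \<open>X = proj v * G\<close> one has \<open>T * G = 1 + t X\<close> and, by rank
  one, \<open>X * X = g X\<close>. Hence \<open>T * (G - s G X) = 1 + (t - s (1 + t g)) X\<close>,
  and the condition on \<open>s\<close> cancels the last term.\<close>

lemma sherman_morrison: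
  assumes Y: "Y \<in> carrier_mat n n" and G: "G \<in> carrier_mat n n" and G': "G' \<in> carrier_mat n n"
    and v: "v \<in> carrier_vec n" and YG: "Y * G = 1\<^sub>m n" and G'Y: "G' * (Y + t \<cdot>\<^sub>m proj v) = 1\<^sub>m n"
    and s: "s * (1 + t * ((G *\<^sub>v v) \<bullet>c v)) = t"
  shows "G' = G - s \<cdot>\<^sub>m (G * (proj v * G))"
proof -
  define P where "P = proj v"
  have P: "P \<in> carrier_mat n n" using v by (simp add: P_def)
  define g where "g = (G *\<^sub>v v) \<bullet>c v"
  define X where "X = P * G"
  have X: "X \<in> carrier_mat n n" using P G by (simp add: X_def)
  define T where "T = Y + t \<cdot>\<^sub>m P"
  have T: "T \<in> carrier_mat n n" using P Y by (simp add: T_def)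
  have PGX: "P * (G * P) = g \<cdot>\<^sub>m P" unfolding P_def g_def by (rule proj_sandwich[OF G v])
  have "X * X = P * (G * P) * G" unfolding X_def
    using P G by (simp add: assoc_mult_mat[of _ n n _ n _ n])
  then have XX: "X * X = g \<cdot>\<^sub>m X" unfolding PGX X_def using P G by (simp add: mult_smult_assoc_mat[of _ n n _ n])
  have TG: "T * G = 1\<^sub>m n + t \<cdot>\<^sub>m X" unfolding T_def X_def
    using Y P G by (simp add: add_mult_distrib_mat[of _ n n _ _ n] YG mult_smult_assoc_mat[of _ n n _ n])
  have GX: "G * X \<in> carrier_mat n n" using G X by simp
  have "T * (G * X) = (T * G) * X" using T G X by (simp add: assoc_mult_mat[of _ n n _ n _ n])
  also have "\<dots> = X + t \<cdot>\<^sub>m (g \<cdot>\<^sub>m X)" unfolding TG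
    using X by (simp add: add_mult_distrib_mat[of _ n n _ _ n] mult_smult_assoc_mat[of _ n n _ n] XX)
  finally have TGX: "T * (G * X) = X + t \<cdot>\<^sub>m (g \<cdot>\<^sub>m X)" .
  have "T * (G - s \<cdot>\<^sub>m (G * X)) = T * G - s \<cdot>\<^sub>m (T * (G * X))"
    using T G GX by (simp add: mult_minus_distrib_mat[of _ n n _ n] mult_smult_distrib[of _ n n _ n])
  also have "\<dots> = 1\<^sub>m n"
  proof (rule eq_matI)
    fix i j assume "i < dim_row (1\<^sub>m n :: complex mat)" "j < dim_col (1\<^sub>m n :: complex mat)"
    then have ij: "i < n" "j < n" by auto
    have "s * (1 + t * g) * X $$ (i,j) = t * X $$ (i,j)" using s by (simp add: g_def)
    then show "(T * G - s \<cdot>\<^sub>m (T * (G * X))) $$ (i,j) = 1\<^sub>m n $$ (i,j)"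
      unfolding TG TGX using ij X by (simp add: algebra_simps)
  qed (use X in \<open>auto simp: TG TGX\<close>)
  finally have one: "T * (G - s \<cdot>\<^sub>m (G * X)) = 1\<^sub>m n" .
  have W: "G - s \<cdot>\<^sub>m (G * X) \<in> carrier_mat n n" using GX by (simp add: minus_carrier_mat)
  \<comment> \<open>A left inverse and a right inverse of the same matrix coincide.\<close>
  have "G' = G' * (T * (G - s \<cdot>\<^sub>m (G * X)))" using one G' by simp
  also have "\<dots> = G' * T * (G - s \<cdot>\<^sub>m (G * X))" by (rule assoc_mult_mat[OF G' T W, symmetric])
  also have "\<dots> = G - s \<cdot>\<^sub>m (G * X)" using left_mult_one_mat[OF W] G'Y by (simp only: T_def P_def)
  finally show ?thesis by (simp add: X_def P_def)
qed

lemma psd_matI: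
  assumes "A \<in> carrier_mat n n" "adj A = A" "\<And>v. v \<in> carrier_vec n \<Longrightarrow> qform A v \<ge> 0"
  shows "psd_mat A"
  using assms by (auto simp: psd_mat_def hermitian_mat_def qform_def)

lemma adj_add: "A \<in> carrier_mat n m \<Longrightarrow> B \<in> carrier_mat n m \<Longrightarrow> adj (A + B) = adj A + adj B"
  by (rule eq_matI) auto

lemma adj_smult_real: "adj (complex_of_real c \<cdot>\<^sub>m A) = complex_of_real c \<cdot>\<^sub>m adj A"
  by (rule eq_matI) auto

text \<open>Moving \<open>Z\<close> by \<open>t\<close> times \<open>proj v\<close> changes the cost
  by exactly \<open>L * t * q - s * x\<close> with \<open>s = t / (1 + t * g)\<close>, where
  \<open>x\<close> and \<open>q\<close> are the two quadratic forms to be compared. Minimality makes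
  this nonnegative; dividing by \<open>t\<close> and letting \<open>t\<close> tend to 0 gives the
  bound.\<close>

lemma minimizer_first_order:
  assumes \<rho>: "\<rho> \<in> carrier_mat n n" and \<sigma>: "\<sigma> \<in> carrier_mat n n"
    and \<sigma>0: "\<And>v. v \<in> carrier_vec n \<Longrightarrow> 0 \<le> qform \<sigma> v" and L: "L > 0"
    and U: "unitary_mat n U" and z: "\<And>i. 0 \<le> z i"
    and min: "\<And>U' z'. unitary_mat n U' \<Longrightarrow> (\<And>i. i < n \<Longrightarrow> 0 \<le> z' i) \<Longrightarrow> cost n \<rho> \<sigma> L U z \<le> cost n \<rho> \<sigma> L U' z'"
    and v: "v \<in> carrier_vec n"
  shows "qform \<rho> (spectral n U (\<lambda>i. 1 / (1 + z i)) *\<^sub>v v) \<le> L * qform \<sigma> v"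
proof -
  note Uc = unitary_carrier[OF U]
  define G where "G = spectral n U (\<lambda>i. 1 / (1 + z i))"
  define Z where "Z = spectral n U z"
  have G: "G \<in> carrier_mat n n" "adj G = G" and Z: "Z \<in> carrier_mat n n" "adj Z = Z"
    using Uc by (auto simp: G_def Z_def)
  define g where "g = qform G v"
  have g: "g \<ge> 0" unfolding g_def G_def qform_spectral[OF Uc v] using z by (intro sum_nonneg) simp
  have gg: "(G *\<^sub>v v) \<bullet>c v = complex_of_real g" unfolding g_def by (rule hermitian_cinner_real[OF G v])
  define P where "P = proj v"
  have P: "P \<in> carrier_mat n n" "adj P = P" using v by (auto simp: P_def)
  define x where "x = qform \<rho> (G *\<^sub>v v)"
  define q where "q = qform \<sigma> v"
  have q: "q \<ge> 0" using \<sigma>0[OF v] by (simp add: q_def)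
  have key: "x \<le> L * q * (1 + t * g)" if t: "t > 0" for t
  proof -
    define s where "s = t / (1 + t * g)"
    have tg: "1 + t * g > 0" using t g by (simp add: add_pos_nonneg)
    define W where "W = Z + complex_of_real t \<cdot>\<^sub>m P"
    have W: "W \<in> carrier_mat n n" using Z P by (simp add: W_def)
    have "psd_mat W"
    proof (rule psd_matI[OF W])
      show "adj W = W" unfolding W_def using Z P by (simp add: adj_add[of _ n n] adj_smult_real)
      fix w :: "complex vec" assume w: "w \<in> carrier_vec n"
      have "qform Z w \<ge> 0" unfolding Z_def qform_spectral[OF Uc w] using z by (intro sum_nonneg) simp
      moreover have "qform P w \<ge> 0" using qform_proj[OF v w] by (simp add: P_def)
      ultimately show "qform W w \<ge> 0"
        unfolding W_def using Z P w t by (simp add: qform_add[of _ n] qform_smult[of _ n])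
    qed
    \<comment> \<open>The perturbed matrix has an eigenbasis of its own, so the comparison draws on
      minimality over all unitaries and not just over eigenvalues in the basis
      \<open>U\<close>.\<close>
    then obtain U' z' where U': "unitary_mat n U'" and WU: "W = spectral n U' z'" and z': "\<And>i. z' i \<ge> 0"
      using psd_spectral[OF _ W] by metis
    note U'c = unitary_carrier[OF U']
    define G' where "G' = spectral n U' (\<lambda>i. 1 / (1 + z' i))"
    have G': "G' \<in> carrier_mat n n" using U'c by (simp add: G'_def)
    have Y: "1\<^sub>m n + Z \<in> carrier_mat n n" using Z by simp
    have WY: "1\<^sub>m n + W = (1\<^sub>m n + Z) + complex_of_real t \<cdot>\<^sub>m proj v"
      unfolding W_def P_def[symmetric] using Z P by (simp add: assoc_add_mat[of _ n n])
    have "G' = G - complex_of_real s \<cdot>\<^sub>m (G * (proj v * G))"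
    proof (rule sherman_morrison[OF Y G(1) G' v])
      show "(1\<^sub>m n + Z) * G = 1\<^sub>m n" unfolding Z_def G_def by (rule spectral_inverse(1)[OF U z])
      show "G' * (1\<^sub>m n + Z + complex_of_real t \<cdot>\<^sub>m proj v) = 1\<^sub>m n"
        unfolding WY[symmetric] G'_def WU by (rule spectral_inverse(2)[OF U' z'])
      have "s * (1 + t * g) = t" using tg by (simp add: s_def)
      then have "complex_of_real (s * (1 + t * g)) = complex_of_real t" by simp
      then show "complex_of_real s * (1 + complex_of_real t * ((G *\<^sub>v v) \<bullet>c v)) = complex_of_real t"
        unfolding gg by simp
    qed
    then have G'eq: "G' = G - complex_of_real s \<cdot>\<^sub>m (G * (P * G))" by (simp add: P_def)
    have "mtrace (\<rho> * (G * (P * G))) = mtrace ((\<rho> * G * P) * G)"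
      using \<rho> G P by (simp add: assoc_mult_mat[of _ n n _ n _ n])
    also have "\<dots> = mtrace (G * (\<rho> * G * P))"
      using \<rho> G P by (intro mtrace_comm[of _ n n]) auto
    also have "\<dots> = mtrace ((G * \<rho> * G) * P)"
      using \<rho> G P by (simp add: assoc_mult_mat[of _ n n _ n _ n])
    also have "\<dots> = (G * \<rho> * G *\<^sub>v v) \<bullet>c v"
      unfolding P_def using \<rho> G v by (intro mtrace_mult_proj) auto
    also have "G * \<rho> * G *\<^sub>v v = G *\<^sub>v (\<rho> *\<^sub>v (G *\<^sub>v v))"
      using \<rho> G v by (simp add: assoc_mult_mat_vec[of _ n n _ n])
    also have "\<dots> \<bullet>c v = (\<rho> *\<^sub>v (G *\<^sub>v v)) \<bullet>c (G *\<^sub>v v)"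
      using cinner_adj[OF G(1) _ v, of "\<rho> *\<^sub>v (G *\<^sub>v v)"] \<rho> G v by simp
    finally have tr: "Re (mtrace (\<rho> * (G * (P * G)))) = x" by (simp add: x_def qform_def)
    have GPG: "G * (P * G) \<in> carrier_mat n n" using G P by simp
    have "\<rho> * G' = \<rho> * G - complex_of_real s \<cdot>\<^sub>m (\<rho> * (G * (P * G)))"
      unfolding G'eq using \<rho> G GPG by (simp add: mult_minus_distrib_mat[of _ n n _ n] mult_smult_distrib[of _ n n _ n])
    then have t1: "Re (mtrace (\<rho> * G')) = Re (mtrace (\<rho> * G)) - s * x"
      using \<rho> G GPG by (simp add: mtrace_minus[of _ n] mtrace_smult[of _ n] tr)
    have "\<sigma> * W = \<sigma> * Z + complex_of_real t \<cdot>\<^sub>m (\<sigma> * P)"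
      unfolding W_def using \<sigma> Z P by (simp add: mult_add_distrib_mat[of _ n n _ n] mult_smult_distrib[of _ n n _ n])
    then have t2: "Re (mtrace (\<sigma> * W)) = Re (mtrace (\<sigma> * Z)) + t * q"
      using \<sigma> Z P mtrace_mult_proj[OF \<sigma> v] by (simp add: mtrace_add[of _ n] mtrace_smult[of _ n] q_def qform_def P_def)
    have "cost n \<rho> \<sigma> L U z \<le> cost n \<rho> \<sigma> L U' z'" using z' by (intro min[OF U']) auto
    then have "0 \<le> L * (t * q) - s * x"
      unfolding cost_eq_mtrace[OF \<rho> \<sigma> Uc] cost_eq_mtrace[OF \<rho> \<sigma> U'c]
        G_def[symmetric] G'_def[symmetric] Z_def[symmetric] WU[symmetric] t1 t2 by (simp add: algebra_simps)
    then have "t * x / (1 + t * g) \<le> t * (L * q)" by (simp add: s_def mult_ac)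
    then have "t * x \<le> t * (L * q) * (1 + t * g)" using tg by (simp add: pos_divide_le_eq)
    then have "t * x \<le> t * (L * q * (1 + t * g))" by (simp add: mult.assoc)
    then show ?thesis using t by simp
  qed
  have "x \<le> L * q + e" if e: "e > 0" for e
  proof -
    \<comment> \<open>Chosen so that \<open>L * q * g * t \<le> e\<close>; the added 1 keeps the
      denominator positive when \<open>L * q * g\<close> is 0.\<close>
    define t where "t = e / (L * q * g + 1)"
    have d: "L * q * g \<ge> 0" using L q g by simp
    then have t: "t > 0" using e by (simp add: t_def)
    have "L * q * g * t \<le> (L * q * g + 1) * t" using t by simp
    also have "\<dots> = e" using d by (simp add: t_def)
    finally show ?thesis using key[OF t] by (simp add: algebra_simps)
  qed
  then have "x \<le> L * q" by (rule field_le_epsilon)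
  then show ?thesis by (simp add: x_def q_def G_def)
qed

text \<open>Resetting \<open>z i\<close> to 0 leaves the other summands alone. Were
  \<open>z i\<close> positive, \<open>p \<le> L * q\<close> would make the old summand at least
  \<open>p * (z i + 1 / (1 + z i))\<close>, which exceeds the new summand \<open>p\<close>.\<close>

lemma minimizer_zero:
  assumes min: "\<And>z'. (\<And>i. i < n \<Longrightarrow> 0 \<le> z' i) \<Longrightarrow> cost n \<rho> \<sigma> L U z \<le> cost n \<rho> \<sigma> L U z'"
    and z: "\<And>i. 0 \<le> z i" and i: "i < n"
    and p: "0 < qform \<rho> (col U i)" "qform \<rho> (col U i) \<le> L * qform \<sigma> (col U i)"
  shows "z i = 0"
proof (rule ccontr)
  assume "z i \<noteq> 0"
  then have zi: "z i > 0" using z[of i] by simp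
  let ?c = "\<lambda>z j. L * z j * qform \<sigma> (col U j) + qform \<rho> (col U j) / (1 + z j)"
  have "cost n \<rho> \<sigma> L U z \<le> cost n \<rho> \<sigma> L U (z(i := 0))" using z by (intro min) auto
  moreover have "(\<Sum>j\<in>{..<n}-{i}. ?c z j) = (\<Sum>j\<in>{..<n}-{i}. ?c (z(i := 0)) j)"
    by (intro sum.cong) auto
  ultimately have "?c z i \<le> ?c (z(i := 0)) i"
    unfolding cost_def using i by (simp add: sum.remove[of "{..<n}" i])
  then have le: "L * z i * qform \<sigma> (col U i) + qform \<rho> (col U i) / (1 + z i) \<le> qform \<rho> (col U i)" by simp
  have "qform \<rho> (col U i) * z i \<le> L * z i * qform \<sigma> (col U i)"
    using mult_right_mono[OF p(2), of "z i"] zi by (simp add: mult_ac)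
  with le have "qform \<rho> (col U i) * z i + qform \<rho> (col U i) / (1 + z i) \<le> qform \<rho> (col U i)" by linarith
  then have "qform \<rho> (col U i) * (z i + 1 / (1 + z i)) \<le> qform \<rho> (col U i) * 1" by (simp add: algebra_simps)
  then have "z i + 1 / (1 + z i) \<le> 1" using p(1) by (simp only: mult_le_cancel_left_pos)
  moreover have "1 < z i + 1 / (1 + z i)" using zi by (simp add: field_simps)
  ultimately show False by simp
qed

subsection \<open>Relative entropy under measurement\<close>

text \<open>The difference of the two sides, with both arguments shifted by \<open>t\<close>, is nondecreasing in \<open>t\<close>
  and tends to 0.\<close>

lemma ln_mean_le_if_resolvent_le:
  fixes P x :: "'a \<Rightarrow> real" and p y :: "'b \<Rightarrow> real"
  assumes fin: "finite A" "finite B"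
    and A: "\<And>a. a \<in> A \<Longrightarrow> P a > 0 \<and> x a > 0"
    and B: "\<And>b. b \<in> B \<Longrightarrow> p b > 0 \<and> y b > 0"
    and total: "sum P A = sum p B"
    and le: "\<And>t. t > 0 \<Longrightarrow> (\<Sum>b\<in>B. p b / (y b + t)) \<le> (\<Sum>a\<in>A. P a / (x a + t))"
  shows "(\<Sum>a\<in>A. P a * ln (x a)) \<le> (\<Sum>b\<in>B. p b * ln (y b))"
proof -
  define \<Phi> where "\<Phi> t = (\<Sum>a\<in>A. P a * ln (x a + t)) - (\<Sum>b\<in>B. p b * ln (y b + t))" for t
  define C where "C = (\<Sum>a\<in>A. P a * x a)"
  have C: "C \<ge> 0" unfolding C_def using A by (intro sum_nonneg) (simp add: less_imp_le)
  have bound: "\<Phi> 0 \<le> C / t" if t: "t > 0" for t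
  proof -
    have "\<Phi> 0 \<le> \<Phi> t"
    proof (rule DERIV_nonneg_imp_increasing_open[where f = \<Phi>])
      show "0 \<le> t" using t by simp
      fix u assume u: "0 < u" "u < t"
      have "(\<Phi> has_real_derivative (\<Sum>a\<in>A. P a * (1 / (x a + u))) - (\<Sum>b\<in>B. p b * (1 / (y b + u)))) (at u)"
        unfolding \<Phi>_def using A B u
        by (auto intro!: derivative_eq_intros sum.cong simp: add_pos_pos)
      moreover have "0 \<le> (\<Sum>a\<in>A. P a * (1 / (x a + u))) - (\<Sum>b\<in>B. p b * (1 / (y b + u)))"
        using le[OF u(1)] by simp
      ultimately show "\<exists>d. (\<Phi> has_real_derivative d) (at u) \<and> 0 \<le> d" by blast
    next
      have "x a + u \<noteq> 0" if "a \<in> A" "u \<in> {0..t}" for a u using A[OF that(1)] that(2) by auto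
      moreover have "y a + u \<noteq> 0" if "a \<in> B" "u \<in> {0..t}" for a u using B[OF that(1)] that(2) by auto
      ultimately show "continuous_on {0..t} \<Phi>"
        unfolding \<Phi>_def by (intro continuous_intros) auto
    qed
    \<comment> \<open>Equal total masses allow \<open>ln t\<close> to be subtracted from every
      logarithm. Then the first sum is at most \<open>C / t\<close> and the second is
      nonnegative.\<close>
    also have "\<Phi> t = (\<Sum>a\<in>A. P a * (ln (x a + t) - ln t)) - (\<Sum>b\<in>B. p b * (ln (y b + t) - ln t))"
      unfolding \<Phi>_def right_diff_distrib sum_subtractf sum_distrib_right[symmetric] total by simp
    also have "\<dots> \<le> (\<Sum>a\<in>A. P a * (x a / t)) - 0"
    proof (intro diff_mono sum_mono sum_nonneg mult_left_mono mult_nonneg_nonneg)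
      fix a assume a: "a \<in> A"
      have "1 + x a / t = (x a + t) / t" using t by (simp add: field_simps)
      then have "ln (x a + t) - ln t = ln (1 + x a / t)"
        using A[OF a] t by (simp add: ln_div)
      also have "\<dots> \<le> x a / t" using A[OF a] t by (intro ln_add_one_self_le_self) simp
      finally show "ln (x a + t) - ln t \<le> x a / t" .
    next
      fix b assume b: "b \<in> B"
      show "0 \<le> ln (y b + t) - ln t" using B[OF b] t by simp
    qed (use A B in \<open>auto simp: less_imp_le\<close>)
    also have "\<dots> = C / t" by (simp add: C_def sum_divide_distrib)
    finally show ?thesis .
  qed
  have "\<Phi> 0 \<le> 0 + e" if e: "e > 0" for e
  proof -
    have t: "(C + 1) / e > 0" using C e by simp
    have "\<Phi> 0 \<le> C / ((C + 1) / e)" by (rule bound[OF t])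
    also have "\<dots> \<le> e" using C e by (simp add: field_simps)
    finally show ?thesis by simp
  qed
  then have "\<Phi> 0 \<le> 0" by (rule field_le_epsilon)
  then show ?thesis by (simp add: \<Phi>_def)
qed

section \<open>Parseval and trace identities for a pair of bases\<close>

lemma Cauchy_Schwarz_sum:
  fixes f g :: "'a \<Rightarrow> real"
  shows "(\<Sum>i\<in>A. f i * g i)\<^sup>2 \<le> (\<Sum>i\<in>A. (f i)\<^sup>2) * (\<Sum>i\<in>A. (g i)\<^sup>2)"
proof -
  have "\<bar>\<Sum>i\<in>A. f i * g i\<bar> \<le> (\<Sum>i\<in>A. \<bar>f i\<bar> * \<bar>g i\<bar>)"
    by (rule order_trans[OF sum_abs]) (simp add: abs_mult)
  also have "\<dots> \<le> L2_set f A * L2_set g A" by (rule L2_set_mult_ineq)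
  finally have "\<bar>\<Sum>i\<in>A. f i * g i\<bar>\<^sup>2 \<le> (L2_set f A * L2_set g A)\<^sup>2" by (intro power_mono) auto
  then show ?thesis by (simp add: power_mult_distrib L2_set_def sum_nonneg)
qed

lemma parseval:
  assumes V: "unitary_mat n V" and v: "v \<in> carrier_vec n" and w: "w \<in> carrier_vec n"
  shows "v \<bullet>c w = (\<Sum>b<n. (v \<bullet>c col V b) * (col V b \<bullet>c w))"
proof -
  note c = unitary_carrier[OF V]
  have idx: "(adj V *\<^sub>v u) $ b = u \<bullet>c col V b" if "u \<in> carrier_vec n" "b < n" for u b
    unfolding mult_vec_index[OF adj_carrier[OF c] that] cinner_sum[OF col_carrier_vec[OF that(2) c]]
    using c that by (intro sum.cong) auto
  have "V *\<^sub>v (adj V *\<^sub>v v) = (V * adj V) *\<^sub>v v"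
    by (rule assoc_mult_mat_vec[OF c adj_carrier[OF c] v, symmetric])
  then have "v \<bullet>c w = (V *\<^sub>v (adj V *\<^sub>v v)) \<bullet>c w" using v by (simp add: unitary_right[OF V])
  also have "\<dots> = (adj V *\<^sub>v v) \<bullet>c (adj V *\<^sub>v w)"
    by (rule cinner_adj[OF c mult_mat_vec_carrier[OF adj_carrier[OF c] v] w])
  also have "\<dots> = (\<Sum>b<n. (v \<bullet>c col V b) * cnj (w \<bullet>c col V b))"
    unfolding cinner_sum[OF mult_mat_vec_carrier[OF adj_carrier[OF c] w]]
    by (intro sum.cong refl) (simp add: idx v w del: index_mult_mat_vec)
  also have "\<dots> = (\<Sum>b<n. (v \<bullet>c col V b) * (col V b \<bullet>c w))"
    using cinner_commute[OF _ w] c by (intro sum.cong refl) simp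
  finally show ?thesis .
qed

lemma parseval_norm:
  assumes V: "unitary_mat n V" and v: "v \<in> carrier_vec n"
  shows "(\<Sum>b<n. (cmod (v \<bullet>c col V b))\<^sup>2) = Re (v \<bullet>c v)"
proof -
  note c = unitary_carrier[OF V]
  have "v \<bullet>c v = (\<Sum>b<n. (v \<bullet>c col V b) * cnj (v \<bullet>c col V b))"
    unfolding parseval[OF V v v] using cinner_commute[OF _ v] c by (intro sum.cong refl) simp
  then have "v \<bullet>c v = complex_of_real (\<Sum>b<n. (cmod (v \<bullet>c col V b))\<^sup>2)"
    unfolding of_real_sum complex_norm_square .
  then show ?thesis by simp
qed

lemma cinner_cmod_commute:
  assumes "v \<in> carrier_vec n" "w \<in> carrier_vec n"
  shows "cmod (v \<bullet>c w) = cmod (w \<bullet>c v)"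
  using cinner_commute[OF assms] by simp

text \<open>The trace of the product of the two matrices, expanded in either eigenbasis. It trades
  sums over the eigenvectors of a state for sums over the measured basis.\<close>

lemma qform_spectral_swap:
  assumes U: "U \<in> carrier_mat n n" and E: "E \<in> carrier_mat n n"
  shows "(\<Sum>a<n. l a * qform (spectral n E y) (col U a)) = (\<Sum>i<n. y i * qform (spectral n U l) (col E i))"
  using Re_mtrace_mult_spectral[OF spectral_carrier[OF E] U, of y l]
    Re_mtrace_mult_spectral[OF spectral_carrier[OF U] E, of l y]
    mtrace_comm[OF spectral_carrier[OF U, of l] spectral_carrier[OF E, of y]]
  by simp

lemma sum_qform_basis:
  assumes A: "A \<in> carrier_mat n n" and E: "unitary_mat n E"
  shows "(\<Sum>i<n. qform A (col E i)) = Re (mtrace A)"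
  using Re_mtrace_mult_spectral[OF A unitary_carrier[OF E], of "\<lambda>_. 1"] A
  by (simp add: spectral_one[OF E])

lemma spectral_norm_square:
  assumes E: "unitary_mat n E" and v: "v \<in> carrier_vec n"
  shows "Re ((spectral n E x *\<^sub>v v) \<bullet>c (spectral n E x *\<^sub>v v)) = qform (spectral n E (\<lambda>i. x i * x i)) v"
proof -
  note c = unitary_carrier[OF E]
  note X = spectral_carrier[OF c, of x]
  have Xv: "spectral n E x *\<^sub>v v \<in> carrier_vec n" using X v by simp
  have "(spectral n E x *\<^sub>v (spectral n E x *\<^sub>v v)) \<bullet>c v = (spectral n E x *\<^sub>v v) \<bullet>c (spectral n E x *\<^sub>v v)"
    using cinner_adj[OF X Xv v] c by simp
  moreover have "spectral n E x *\<^sub>v (spectral n E x *\<^sub>v v) = spectral n E (\<lambda>i. x i * x i) *\<^sub>v v"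
    unfolding assoc_mult_mat_vec[OF X X v, symmetric] spectral_mult[OF E] ..
  ultimately show ?thesis by (simp add: qform_def)
qed

text \<open>The Nussbaum-Szkola distributions of the pair have masses \<open>l a * overlap a b\<close> and
  \<open>s b * overlap a b\<close>; their classical relative entropy is the quantum one.\<close>

locale state_pair =
  fixes n :: nat and U V :: "complex mat" and l s :: "nat \<Rightarrow> real"
  assumes U: "unitary_mat n U" and V: "unitary_mat n V"
    and l0: "\<And>a. 0 \<le> l a" and s0: "\<And>b. 0 \<le> s b"
    and kernel: "\<And>v. v \<in> carrier_vec n \<Longrightarrow> spectral n V s *\<^sub>v v = 0\<^sub>v n \<Longrightarrow> spectral n U l *\<^sub>v v = 0\<^sub>v n"
begin

definition overlap :: "nat \<Rightarrow> nat \<Rightarrow> real" where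
  "overlap a b = (cmod (col V b \<bullet>c col U a))\<^sup>2"

lemma Uc: "U \<in> carrier_mat n n" and Vc: "V \<in> carrier_mat n n"
  using U V by (auto dest: unitary_carrier)

lemma colU: "a < n \<Longrightarrow> col U a \<in> carrier_vec n" and colV: "b < n \<Longrightarrow> col V b \<in> carrier_vec n"
  using Uc Vc by auto

text \<open>\<open>col V b\<close> lies in the kernel of \<open>spectral n V s\<close>, hence in
  that of \<open>spectral n U l\<close>, and the kernel of a Hermitian matrix is orthogonal to its
  eigenvectors of nonzero eigenvalue.\<close>

lemma overlap_kernel:
  assumes ab: "a < n" "b < n" and la: "l a > 0" and sb: "s b = 0"
  shows "col V b \<bullet>c col U a = 0"
proof -
  have "spectral n V s *\<^sub>v col V b = 0\<^sub>v n"
    unfolding spectral_eigenvector[OF V ab(2)] sb using colV[OF ab(2)] carrier_matD[OF Vc] by (intro eq_vecI) auto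
  then have "spectral n U l *\<^sub>v col V b = 0\<^sub>v n" by (rule kernel[OF colV[OF ab(2)]])
  then have "0 = (spectral n U l *\<^sub>v col V b) \<bullet>c col U a" using colU[OF ab(1)] by simp
  also have "\<dots> = col V b \<bullet>c (complex_of_real (l a) \<cdot>\<^sub>v col U a)"
    using cinner_adj[OF spectral_carrier[OF Uc] colV[OF ab(2)] colU[OF ab(1)]] Uc
    by (simp add: spectral_eigenvector[OF U ab(1)])
  also have "\<dots> = complex_of_real (l a) * (col V b \<bullet>c col U a)"
    using colU[OF ab(1)] Uc ab
    by (simp add: cinner_sum[of _ n] sum_distrib_left mult_ac)
  finally show ?thesis using la by simp
qed

lemma sum_overlap: "a < n \<Longrightarrow> (\<Sum>b<n. overlap a b) = 1"
  using parseval_norm[OF V colU, of a] unitary_col_cinner[OF U, of a a]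
  by (simp add: overlap_def cinner_cmod_commute[OF colU colV])

text \<open>The terms with \<open>s b = 0\<close> are \<open>0\<close> by division by zero; they do not matter by
  \<open>overlap_kernel\<close>.\<close>

lemma dominated:
  assumes v: "v \<in> carrier_vec n"
  shows "qform (spectral n U l) v \<le> (\<Sum>a<n. l a * (\<Sum>b<n. overlap a b / s b)) * qform (spectral n V s) v"
  unfolding qform_spectral[OF Uc v] sum_distrib_right
proof (rule sum_mono)
  fix a assume "a \<in> {..<n}"
  then have a: "a < n" by simp
  show "l a * (cmod (v \<bullet>c col U a))\<^sup>2 \<le> l a * (\<Sum>b<n. overlap a b / s b) * qform (spectral n V s) v"
  proof (cases "l a = 0")
    case False
    then have la: "l a > 0" using l0[of a] by simp
    have "cmod (v \<bullet>c col U a) \<le> (\<Sum>b<n. cmod ((v \<bullet>c col V b) * (col V b \<bullet>c col U a)))"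
      unfolding parseval[OF V v colU[OF a]] by (rule norm_sum)
    \<comment> \<open>Inserting \<open>sqrt (s b)\<close> and its inverse makes the first
      Cauchy-Schwarz factor the quadratic form of \<open>spectral n V s\<close>; the second is
      independent of \<open>v\<close>.\<close>
    also have "\<dots> = (\<Sum>b<n. (sqrt (s b) * cmod (v \<bullet>c col V b)) * (cmod (col V b \<bullet>c col U a) / sqrt (s b)))"
    proof (intro sum.cong refl)
      fix b assume b: "b \<in> {..<n}"
      show "cmod ((v \<bullet>c col V b) * (col V b \<bullet>c col U a)) =
          (sqrt (s b) * cmod (v \<bullet>c col V b)) * (cmod (col V b \<bullet>c col U a) / sqrt (s b))"
        using overlap_kernel[OF a _ la, of b] b by (cases "s b = 0") (auto simp: norm_mult)
    qed
    finally have "(cmod (v \<bullet>c col U a))\<^sup>2 \<le>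
        (\<Sum>b<n. (sqrt (s b) * cmod (v \<bullet>c col V b)) * (cmod (col V b \<bullet>c col U a) / sqrt (s b)))\<^sup>2"
      by (intro power_mono) auto
    also have "\<dots> \<le> (\<Sum>b<n. (sqrt (s b) * cmod (v \<bullet>c col V b))\<^sup>2) * (\<Sum>b<n. (cmod (col V b \<bullet>c col U a) / sqrt (s b))\<^sup>2)"
      by (rule Cauchy_Schwarz_sum)
    also have "\<dots> = qform (spectral n V s) v * (\<Sum>b<n. overlap a b / s b)"
      unfolding qform_spectral[OF Vc v] using s0 by (simp add: power_mult_distrib power_divide overlap_def)
    finally show ?thesis using la by (simp add: mult.assoc mult.commute[of "qform (spectral n V s) v"])
  qed simp
qed

text \<open>The logarithm of the first matrix contributes a term in \<open>a\<close> alone. Since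
  the overlaps of a fixed \<open>a\<close> sum to 1, it spreads over all pairs, and both logarithms
  then carry the same weights.\<close>

lemma relative_entropy_eq:
  "Re (mtrace (spectral n U l * (spectral n U (\<lambda>a. log2_supp (l a)) - spectral n V (\<lambda>b. log2_supp (s b))))) =
    (\<Sum>a<n. \<Sum>b<n. l a * overlap a b * (log2_supp (l a) - log2_supp (s b)))"
proof -
  note c = spectral_carrier[OF Uc] spectral_carrier[OF Vc]
  let ?r = "spectral n U l"
  have "mtrace (?r * (spectral n U (\<lambda>a. log2_supp (l a)) - spectral n V (\<lambda>b. log2_supp (s b)))) =
      mtrace (?r * spectral n U (\<lambda>a. log2_supp (l a))) - mtrace (?r * spectral n V (\<lambda>b. log2_supp (s b)))"
    using c by (simp add: mult_minus_distrib_mat[of _ n n _ n] mtrace_minus[of _ n])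
  then have "Re (mtrace (?r * (spectral n U (\<lambda>a. log2_supp (l a)) - spectral n V (\<lambda>b. log2_supp (s b))))) =
      (\<Sum>a<n. log2_supp (l a) * qform ?r (col U a)) - (\<Sum>b<n. log2_supp (s b) * qform ?r (col V b))"
    by (simp add: Re_mtrace_mult_spectral[OF c(1) Uc] Re_mtrace_mult_spectral[OF c(1) Vc])
  also have "(\<Sum>a<n. log2_supp (l a) * qform ?r (col U a)) = (\<Sum>a<n. \<Sum>b<n. l a * overlap a b * log2_supp (l a))"
    by (intro sum.cong refl)
      (simp add: qform_spectral_col[OF U] sum_distrib_left[symmetric] sum_distrib_right[symmetric] sum_overlap)
  also have "(\<Sum>b<n. log2_supp (s b) * qform ?r (col V b)) = (\<Sum>b<n. \<Sum>a<n. l a * overlap a b * log2_supp (s b))"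
    by (intro sum.cong refl) (simp add: qform_spectral[OF Uc] colV overlap_def sum_distrib_left mult_ac)
  also have "\<dots> = (\<Sum>a<n. \<Sum>b<n. l a * overlap a b * log2_supp (s b))" by (rule sum.swap)
  finally show ?thesis by (simp add: right_diff_distrib sum_subtractf)
qed

text \<open>AM-GM with the optimal test observable, of eigenvalues \<open>p i / (q i + t * p i)\<close>.\<close>

lemma measured_resolvent_le:
  assumes E: "unitary_mat n E" and t: "t > 0"
  defines "p \<equiv> \<lambda>i. qform (spectral n U l) (col E i)" and "q \<equiv> \<lambda>i. qform (spectral n V s) (col E i)"
  shows "(\<Sum>i<n. (p i)\<^sup>2 / (q i + t * p i)) \<le> (\<Sum>a<n. \<Sum>b<n. (l a)\<^sup>2 * overlap a b / (s b + t * l a))"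
proof -
  note Ec = unitary_carrier[OF E]
  define x where "x i = p i / (q i + t * p i)" for i
  define X where "X = spectral n E x"
  have X: "X \<in> carrier_mat n n" "adj X = X" using Ec by (auto simp: X_def)
  define B where "B a b = (X *\<^sub>v col U a) \<bullet>c col V b" for a b
  have XU: "X *\<^sub>v col U a \<in> carrier_vec n" if "a < n" for a using X colU[OF that] by simp
  have XV: "X *\<^sub>v col V b \<in> carrier_vec n" if "b < n" for b using X colV[OF that] by simp
  have "(\<Sum>i<n. x i * p i) = (\<Sum>a<n. l a * qform X (col U a))"
    unfolding p_def X_def by (rule qform_spectral_swap[OF Uc Ec, symmetric])
  also have "\<dots> = (\<Sum>a<n. \<Sum>b<n. l a * Re (B a b * (col V b \<bullet>c col U a)))"
    by (intro sum.cong refl)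
      (simp add: qform_def parseval[OF V XU colU] B_def sum_distrib_left)
  also have "\<dots> \<le> (\<Sum>a<n. \<Sum>b<n. ((l a)\<^sup>2 * overlap a b / (s b + t * l a) + (s b + t * l a) * (cmod (B a b))\<^sup>2) / 2)"
  proof (intro sum_mono)
    fix a b assume "a \<in> {..<n}" "b \<in> {..<n}"
    define w where "w = s b + t * l a"
    have w0: "w \<ge> 0" using s0[of b] l0[of a] t by (simp add: w_def)
    show "l a * Re (B a b * (col V b \<bullet>c col U a)) \<le> ((l a)\<^sup>2 * overlap a b / (s b + t * l a) + (s b + t * l a) * (cmod (B a b))\<^sup>2) / 2"
    \<comment> \<open>If \<open>l a = 0\<close> the weight \<open>w\<close> may vanish too, but then
      the left side is 0 and the right side nonnegative.\<close>
    proof (cases "l a = 0")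
      case True then show ?thesis using s0[of b] by simp
    next
      case False
      then have "t * l a > 0" using t l0[of a] by simp
      then have w: "w > 0" using s0[of b] by (simp add: w_def)
      define \<alpha> where "\<alpha> = l a * cmod (col V b \<bullet>c col U a)"
      define \<beta> where "\<beta> = cmod (B a b)"
      have "l a * Re (B a b * (col V b \<bullet>c col U a)) \<le> l a * cmod (B a b * (col V b \<bullet>c col U a))"
        by (rule mult_left_mono[OF complex_Re_le_cmod l0])
      also have "\<dots> = \<alpha> * \<beta>" by (simp add: \<alpha>_def \<beta>_def norm_mult)
      also have "\<alpha> * \<beta> \<le> (\<alpha>\<^sup>2 / w + w * \<beta>\<^sup>2) / 2"
      proof -
        have "0 \<le> (\<alpha> - w * \<beta>)\<^sup>2 / w" using w by simp
        also have "\<dots> = \<alpha>\<^sup>2 / w + w * \<beta>\<^sup>2 - 2 * (\<alpha> * \<beta>)"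
          using w by (simp add: power2_eq_square field_simps)
        finally show ?thesis by simp
      qed
      finally show ?thesis by (simp add: \<alpha>_def \<beta>_def w_def overlap_def power_mult_distrib)
    qed
  qed
  also have "\<dots> = ((\<Sum>a<n. \<Sum>b<n. (l a)\<^sup>2 * overlap a b / (s b + t * l a)) +
      ((\<Sum>a<n. \<Sum>b<n. s b * (cmod (B a b))\<^sup>2) + t * (\<Sum>a<n. \<Sum>b<n. l a * (cmod (B a b))\<^sup>2))) / 2"
    by (simp add: sum_divide_distrib[symmetric] sum.distrib distrib_right sum_distrib_left mult.assoc)
  \<comment> \<open>Parseval over \<open>b\<close> completes the squared norm of \<open>X\<close>
    applied to \<open>col U a\<close>. For the weights \<open>s b\<close> the sum over
    \<open>a\<close> does the same at \<open>col V b\<close>, as \<open>X\<close> is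
    Hermitian.\<close>
  also have "(\<Sum>a<n. \<Sum>b<n. l a * (cmod (B a b))\<^sup>2) = (\<Sum>a<n. l a * qform (spectral n E (\<lambda>i. x i * x i)) (col U a))"
    unfolding sum_distrib_left[symmetric] B_def X_def
    by (intro sum.cong refl)
      (simp add: parseval_norm[OF V XU[unfolded X_def]] spectral_norm_square[OF E colU])
  also have "\<dots> = (\<Sum>i<n. x i * x i * p i)" unfolding p_def by (rule qform_spectral_swap[OF Uc Ec])
  also have "(\<Sum>a<n. \<Sum>b<n. s b * (cmod (B a b))\<^sup>2) = (\<Sum>b<n. \<Sum>a<n. s b * (cmod (B a b))\<^sup>2)" by (rule sum.swap)
  also have "\<dots> = (\<Sum>b<n. s b * qform (spectral n E (\<lambda>i. x i * x i)) (col V b))"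
  proof (intro sum.cong refl)
    fix b assume "b \<in> {..<n}"
    then have b: "b < n" by simp
    have "cmod (B a b) = cmod ((X *\<^sub>v col V b) \<bullet>c col U a)" if a: "a < n" for a
      using cinner_adj[OF X(1) colU[OF a] colV[OF b]] X(2) cinner_cmod_commute[OF colU[OF a] XV[OF b]]
      by (simp add: B_def)
    then have "(\<Sum>a<n. s b * (cmod (B a b))\<^sup>2) = s b * (\<Sum>a<n. (cmod ((X *\<^sub>v col V b) \<bullet>c col U a))\<^sup>2)"
      by (simp add: sum_distrib_left)
    then show "(\<Sum>a<n. s b * (cmod (B a b))\<^sup>2) = s b * qform (spectral n E (\<lambda>i. x i * x i)) (col V b)"
      unfolding X_def by (simp add: parseval_norm[OF U XV[OF b, unfolded X_def]] spectral_norm_square[OF E colV[OF b]])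
  qed
  also have "\<dots> = (\<Sum>i<n. x i * x i * q i)" unfolding q_def by (rule qform_spectral_swap[OF Vc Ec])
  finally have le: "(\<Sum>i<n. x i * p i) \<le> ((\<Sum>a<n. \<Sum>b<n. (l a)\<^sup>2 * overlap a b / (s b + t * l a)) +
      ((\<Sum>i<n. x i * x i * q i) + t * (\<Sum>i<n. x i * x i * p i))) / 2" .
  \<comment> \<open>The choice of \<open>x\<close> makes the quadratic terms add up to the linear
    one, so \<open>le\<close> bounds the linear term by half the target plus half of itself.\<close>
  have "(\<Sum>i<n. x i * x i * q i) + t * (\<Sum>i<n. x i * x i * p i) = (\<Sum>i<n. x i * (x i * (q i + t * p i)))"
    unfolding sum_distrib_left sum.distrib[symmetric]
    by (intro sum.cong refl) (simp add: algebra_simps)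
  also have "\<dots> = (\<Sum>i<n. x i * p i)"
  proof (intro sum.cong refl)
    fix i show "x i * (x i * (q i + t * p i)) = x i * p i"
      by (cases "q i + t * p i = 0") (auto simp: x_def)
  qed
  finally have eq: "(\<Sum>i<n. x i * x i * q i) + t * (\<Sum>i<n. x i * x i * p i) = (\<Sum>i<n. x i * p i)" .
  have "(\<Sum>i<n. x i * p i) \<le> (\<Sum>a<n. \<Sum>b<n. (l a)\<^sup>2 * overlap a b / (s b + t * l a))"
    using le unfolding eq by simp
  then show ?thesis by (simp add: x_def power2_eq_square mult_ac)
qed

text \<open>Monotonicity of relative entropy under measurement in the basis \<open>E\<close>. The
  resolvent of a ratio, weighted by its mass, is \<open>p / (q / p + t) = p^2 / (q + t * p)\<close>,
  so \<open>measured_resolvent_le\<close> supplies the hypothesis of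
  \<open>ln_mean_le_if_resolvent_le\<close> for the ratios.\<close>

lemma measured_relative_entropy_le:
  assumes E: "unitary_mat n E"
  defines "p \<equiv> \<lambda>i. qform (spectral n U l) (col E i)" and "q \<equiv> \<lambda>i. qform (spectral n V s) (col E i)"
  shows "(\<Sum>i\<in>{i. i < n \<and> 0 < p i}. p i * ln (p i / q i)) \<le>
    ln 2 * (\<Sum>a<n. \<Sum>b<n. l a * overlap a b * (log2_supp (l a) - log2_supp (s b)))"
proof -
  note Ec = unitary_carrier[OF E]
  define I where "I = {i. i < n \<and> 0 < p i}"
  \<comment> \<open>Outcomes and pairs of zero mass are discarded so that every ratio is positive;
    \<open>single\<close> and \<open>double\<close> lead back to the full sums.\<close>
  define D where "D = {x. fst x < n \<and> snd x < n \<and> 0 < l (fst x) * overlap (fst x) (snd x)}"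
  define P where "P = (\<lambda>x. l (fst x) * overlap (fst x) (snd x))"
  define R where "R = (\<lambda>x. s (snd x) / l (fst x))"
  have colE: "col E i \<in> carrier_vec n" if "i < n" for i using Ec that by simp
  have p0: "p i \<ge> 0" if "i < n" for i
    unfolding p_def qform_spectral[OF Uc colE[OF that]] using l0 by (intro sum_nonneg) simp
  have q0: "q i \<ge> 0" if "i < n" for i
    unfolding q_def qform_spectral[OF Vc colE[OF that]] using s0 by (intro sum_nonneg) simp
  have fD: "finite D" by (rule finite_subset[of _ "{..<n} \<times> {..<n}"]) (auto simp: D_def)
  have fI: "finite I" by (simp add: I_def)
  have D_pos: "l a > 0" "s b > 0" if "(a,b) \<in> D" for a b
  proof -
    have ab: "a < n" "b < n" "0 < l a * overlap a b" using that by (auto simp: D_def)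
    show la: "l a > 0" using ab(3) l0[of a] by (cases "l a = 0") auto
    show "s b > 0"
    proof (rule ccontr)
      assume "\<not> 0 < s b"
      then have "s b = 0" using s0[of b] by simp
      then have "overlap a b = 0" using overlap_kernel[OF ab(1,2) la] by (simp add: overlap_def)
      then show False using ab(3) by simp
    qed
  qed
  have double: "(\<Sum>a<n. \<Sum>b<n. f a b) = (\<Sum>x\<in>D. f (fst x) (snd x))"
    if "\<And>a b. a < n \<Longrightarrow> b < n \<Longrightarrow> l a * overlap a b = 0 \<Longrightarrow> f a b = 0" for f :: "nat \<Rightarrow> nat \<Rightarrow> real"
  proof -
    have "(\<Sum>a<n. \<Sum>b<n. f a b) = (\<Sum>x\<in>{..<n} \<times> {..<n}. f (fst x) (snd x))"
      by (simp add: sum.cartesian_product case_prod_beta)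
    also have "\<dots> = (\<Sum>x\<in>D. f (fst x) (snd x))"
    proof (rule sum.mono_neutral_right)
      show "\<forall>x\<in>{..<n} \<times> {..<n} - D. f (fst x) (snd x) = 0"
      proof
        fix x assume x: "x \<in> {..<n} \<times> {..<n} - D"
        then have "\<not> 0 < l (fst x) * overlap (fst x) (snd x)" by (auto simp: D_def)
        moreover have "0 \<le> l (fst x) * overlap (fst x) (snd x)" using l0 by (simp add: overlap_def)
        ultimately have "l (fst x) * overlap (fst x) (snd x) = 0" by linarith
        then show "f (fst x) (snd x) = 0" using x by (intro that) auto
      qed
    qed (auto simp: D_def)
    finally show ?thesis .
  qed
  have single: "(\<Sum>i<n. f i) = (\<Sum>i\<in>I. f i)" if "\<And>i. i < n \<Longrightarrow> p i = 0 \<Longrightarrow> f i = 0" for f :: "nat \<Rightarrow> real"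
  proof (rule sum.mono_neutral_right)
    show "\<forall>i\<in>{..<n} - I. f i = 0" using that p0 by (force simp: I_def)
  qed (auto simp: I_def)
  \<comment> \<open>\<open>dominated\<close> bounds \<open>p i\<close> by a multiple of
    \<open>q i\<close>, so \<open>q i = 0\<close> would force \<open>p i \<le> 0\<close>.\<close>
  have qI: "q i > 0" if "i \<in> I" for i
    using dominated[OF colE, of i] that q0[of i] by (cases "q i = 0") (auto simp: I_def p_def q_def)
  \<comment> \<open>The ratios put the second state over the first, so both sides are negated
    entropies and the claim follows by a change of sign.\<close>
  have "(\<Sum>x\<in>D. P x * ln (R x)) \<le> (\<Sum>i\<in>I. p i * ln (q i / p i))"
  proof (rule ln_mean_le_if_resolvent_le[OF fD fI])
    show "P x > 0 \<and> R x > 0" if "x \<in> D" for x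
      using that D_pos[of "fst x" "snd x"] by (auto simp: P_def R_def D_def)
    show "p i > 0 \<and> q i / p i > 0" if "i \<in> I" for i using that qI by (auto simp: I_def)
    have "(\<Sum>i<n. p i) = Re (mtrace (spectral n U l))"
      unfolding p_def by (rule sum_qform_basis[OF spectral_carrier[OF Uc] E])
    also have "\<dots> = (\<Sum>a<n. l a)"
      unfolding sum_qform_basis[OF spectral_carrier[OF Uc] U, symmetric]
      by (intro sum.cong refl) (simp add: qform_spectral_col[OF U])
    also have "\<dots> = (\<Sum>a<n. \<Sum>b<n. l a * overlap a b)"
      by (intro sum.cong refl) (simp add: sum_distrib_left[symmetric] sum_overlap)
    finally show "sum P D = sum p I"
      using double[of "\<lambda>a b. l a * overlap a b"] single[of p] by (simp add: P_def)
    fix t :: real assume t: "t > 0"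
    have "(\<Sum>i\<in>I. p i / (q i / p i + t)) = (\<Sum>i\<in>I. (p i)\<^sup>2 / (q i + t * p i))"
    proof (intro sum.cong refl)
      fix i assume "i \<in> I"
      then have "p i > 0" "q i > 0" using qI by (auto simp: I_def)
      then show "p i / (q i / p i + t) = (p i)\<^sup>2 / (q i + t * p i)"
        using t by (simp add: field_simps power2_eq_square)
    qed
    also have "\<dots> = (\<Sum>i<n. (p i)\<^sup>2 / (q i + t * p i))" by (rule single[symmetric]) simp
    also have "\<dots> \<le> (\<Sum>a<n. \<Sum>b<n. (l a)\<^sup>2 * overlap a b / (s b + t * l a))"
      unfolding p_def q_def by (rule measured_resolvent_le[OF E t])
    also have "\<dots> = (\<Sum>x\<in>D. (l (fst x))\<^sup>2 * overlap (fst x) (snd x) / (s (snd x) + t * l (fst x)))"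
      by (rule double) auto
    also have "\<dots> = (\<Sum>x\<in>D. P x / (R x + t))"
    proof (intro sum.cong refl)
      fix x assume "x \<in> D"
      then have "l (fst x) > 0" "s (snd x) > 0" using D_pos[of "fst x" "snd x"] by auto
      then show "(l (fst x))\<^sup>2 * overlap (fst x) (snd x) / (s (snd x) + t * l (fst x)) = P x / (R x + t)"
        using t by (simp add: P_def R_def field_simps power2_eq_square)
    qed
    finally show "(\<Sum>i\<in>I. p i / (q i / p i + t)) \<le> (\<Sum>x\<in>D. P x / (R x + t))" .
  qed
  moreover have "(\<Sum>i\<in>I. p i * ln (p i / q i)) = - (\<Sum>i\<in>I. p i * ln (q i / p i))"
    unfolding sum_negf[symmetric]
  proof (intro sum.cong refl)
    fix i assume "i \<in> I"
    then show "p i * ln (p i / q i) = - (p i * ln (q i / p i))"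
      using qI[of i] by (simp add: I_def ln_div algebra_simps)
  qed
  moreover have "ln 2 * (\<Sum>a<n. \<Sum>b<n. l a * overlap a b * (log2_supp (l a) - log2_supp (s b))) = - (\<Sum>x\<in>D. P x * ln (R x))"
  proof -
    have "ln 2 * (\<Sum>a<n. \<Sum>b<n. l a * overlap a b * (log2_supp (l a) - log2_supp (s b))) =
        (\<Sum>x\<in>D. ln 2 * (l (fst x) * overlap (fst x) (snd x) * (log2_supp (l (fst x)) - log2_supp (s (snd x)))))"
      unfolding sum_distrib_left by (rule double) auto
    also have "\<dots> = (\<Sum>x\<in>D. - (P x * ln (R x)))"
    proof (intro sum.cong refl)
      fix x assume "x \<in> D"
      then have "l (fst x) > 0" "s (snd x) > 0" using D_pos[of "fst x" "snd x"] by auto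
      then show "ln 2 * (l (fst x) * overlap (fst x) (snd x) * (log2_supp (l (fst x)) - log2_supp (s (snd x)))) = - (P x * ln (R x))"
        by (simp add: P_def R_def log2_supp_def log_def ln_div field_simps)
    qed
    finally show ?thesis by (simp add: sum_negf)
  qed
  ultimately show ?thesis by (simp add: I_def)
qed

end

section \<open>Markov's inequality for the measured distributions\<close>

lemma ln2_ge_half: "ln (2::real) \<ge> 1 / 2"
  using ln_ge_iff[of 2 "1 / 2"] exp_half_le2 by simp

text \<open>Markov's inequality wants nonnegative values, while \<open>ln (p i / q i)\<close> may be
  negative. By \<open>p i * ln (p i / q i) \<ge> p i - q i\<close> the terms of \<open>I\<close>
  outside \<open>B\<close> total at least -1, which costs an extra 1. As
  \<open>ln 2 \<ge> 1 / 2\<close> this is at most \<open>2 * ln 2\<close>, and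
  \<open>kprime k \<ge> k + 2\<close> absorbs it. The factor \<open>r\<close> in the exponent of
  \<open>L\<close> becomes the bound \<open>1 / r\<close>.\<close>

lemma bad_mass_le:
  fixes p q :: "nat \<Rightarrow> real"
  assumes p: "\<And>i. i < n \<Longrightarrow> 0 \<le> p i" "(\<Sum>i<n. p i) = 1"
    and q: "\<And>i. i < n \<Longrightarrow> 0 \<le> q i" "(\<Sum>i<n. q i) = 1"
    and abs: "\<And>i. i < n \<Longrightarrow> 0 < p i \<Longrightarrow> 0 < q i"
    and ent: "(\<Sum>i\<in>{i. i < n \<and> 0 < p i}. p i * ln (p i / q i)) \<le> ln 2 * k"
    and r: "r > 1"
  shows "0 \<le> k" "(\<Sum>i\<in>{i. i < n \<and> p i > 2 powr (r * kprime k) * q i}. p i) \<le> 1 / r"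
proof -
  define I where "I = {i. i < n \<and> 0 < p i}"
  define L where "L = 2 powr (r * kprime k)"
  define B where "B = {i. i < n \<and> p i > L * q i}"
  have L: "L > 0" by (simp add: L_def)
  have fI: "finite I" by (simp add: I_def)
  have BI: "B \<subseteq> I" 
  proof
    fix i assume i: "i \<in> B"
    then have "0 \<le> L * q i" using q(1)[of i] L by (auto simp: B_def)
    then show "i \<in> I" using i by (auto simp: B_def I_def)
  qed
  have term_ge: "p i * ln (p i / q i) \<ge> p i - q i" if "i \<in> I" for i
  proof -
    have pos: "p i > 0" "q i > 0" using that abs by (auto simp: I_def)
    have "ln (q i / p i) \<le> q i / p i - 1" using pos by (intro ln_le_minus_one) simp
    then have "p i * ln (q i / p i) \<le> p i * (q i / p i - 1)" using pos by (intro mult_left_mono) auto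
    also have "\<dots> = q i - p i" using pos by (simp add: field_simps)
    finally show ?thesis using pos by (simp add: ln_div algebra_simps)
  qed
  have qle: "sum q S \<le> 1" if "S \<subseteq> I" for S
  proof -
    have "sum q S \<le> sum q {..<n}" using that q(1) by (intro sum_mono2) (auto simp: I_def)
    then show ?thesis using q(2) by simp
  qed
  have pI: "sum p I = 1"
  proof -
    have "sum p {..<n} = sum p I" using p(1) by (intro sum.mono_neutral_right) (force simp: I_def)+
    then show ?thesis using p(2) by simp
  qed
  \<comment> \<open>Gibbs' inequality. With \<open>k \<ge> 0\<close> every summand of
    \<open>kprime k\<close> is nonnegative.\<close>
  have "0 \<le> sum p I - sum q I" using pI qle[of I] by simp
  also have "\<dots> \<le> (\<Sum>i\<in>I. p i * ln (p i / q i))"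
    unfolding sum_subtractf[symmetric] using term_ge by (intro sum_mono) auto
  also have "\<dots> \<le> ln 2 * k" using ent by (simp add: I_def)
  finally show k: "0 \<le> k" by (simp add: zero_le_mult_iff)
  have "log 2 (k + 2) \<ge> 0" using k by (simp add: zero_le_log_cancel_iff)
  then have kk: "kprime k \<ge> k + 2" using k unfolding kprime_def by (simp add: add_nonneg_nonneg)
  then have kp: "kprime k > 0" using k by linarith
  have "sum p B * ln L = (\<Sum>i\<in>B. p i * ln L)" by (rule sum_distrib_right)
  also have "\<dots> \<le> (\<Sum>i\<in>B. p i * ln (p i / q i))"
  proof (rule sum_mono)
    fix i assume i: "i \<in> B"
    then have pos: "p i > 0" "q i > 0" using BI abs by (auto simp: I_def)
    have "L \<le> p i / q i" using i pos by (simp add: B_def pos_le_divide_eq)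
    then have "ln L \<le> ln (p i / q i)" using L pos by (subst ln_le_cancel_iff) auto
    then show "p i * ln L \<le> p i * ln (p i / q i)" using pos by (intro mult_left_mono) auto
  qed
  also have "\<dots> = (\<Sum>i\<in>I. p i * ln (p i / q i)) - (\<Sum>i\<in>I - B. p i * ln (p i / q i))"
    using sum.subset_diff[OF BI fI, of "\<lambda>i. p i * ln (p i / q i)"] by simp
  also have "\<dots> \<le> ln 2 * k + 1"
  proof -
    have "-1 \<le> (\<Sum>i\<in>I - B. p i - q i)"
      unfolding sum_subtractf using qle[of "I - B"] p(1) sum_nonneg[of "I - B" p] by (auto simp: I_def)
    also have "\<dots> \<le> (\<Sum>i\<in>I - B. p i * ln (p i / q i))" using term_ge by (intro sum_mono) auto
    finally show ?thesis using ent by (simp add: I_def)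
  qed
  also have "\<dots> \<le> ln 2 * (k + 2)" using ln2_ge_half by (simp add: algebra_simps)
  also have "\<dots> \<le> ln 2 * kprime k" using kk by (intro mult_left_mono) auto
  finally have "sum p B * (r * kprime k * ln 2) \<le> ln 2 * kprime k" by (simp add: L_def ln_powr)
  then have "(sum p B * r) * (ln 2 * kprime k) \<le> 1 * (ln 2 * kprime k)" by (simp add: mult_ac)
  then have "sum p B * r \<le> 1" using kp by (simp only: mult_le_cancel_right_pos mult_pos_pos ln_gt_zero)
  then show "(\<Sum>i\<in>{i. i < n \<and> p i > 2 powr (r * kprime k) * q i}. p i) \<le> 1 / r"
    using r by (simp add: B_def L_def pos_le_divide_eq)
qed

section \<open>One eigenbasis for the functional calculus\<close>

lemma mat_fun_spectral:
  assumes "A \<in> carrier_mat n n" "adj A = A"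
  obtains U l where "unitary_mat n U" "A = spectral n U l"
    "\<And>f. mat_fun f A = spectral n U (\<lambda>i. f (l i))"
proof -
  let ?Q = "\<lambda>p. unitary_mat n (fst p) \<and> A = fst p * mat_diag n (\<lambda>i. complex_of_real (snd p i)) * adj (fst p)"
  \<comment> \<open>The choice does not mention \<open>f\<close>, so a single unitary and eigenvalue
    list describe \<open>A\<close> and every \<open>mat_fun f A\<close> at once.\<close>
  define p where "p = (SOME p. ?Q p)"
  have "\<exists>p. ?Q p" using spectral_theorem[OF assms] unfolding spectral_def by (metis fst_conv snd_conv)
  then have "?Q p" unfolding p_def by (rule someI_ex)
  moreover have "mat_fun f A = spectral n (fst p) (\<lambda>i. f (snd p i))" for f
    using assms(1) by (simp add: mat_fun_def spectral_def p_def Let_def)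
  ultimately show thesis using that[of "fst p" "snd p"] by (simp add: spectral_def)
qed

lemma psd_mat_fun_spectral:
  assumes "psd_mat A" "A \<in> carrier_mat n n"
  obtains U l where "unitary_mat n U" "\<And>i. l i \<ge> 0" "A = spectral n U l"
    "\<And>f. mat_fun f A = spectral n U (\<lambda>i. f (l i))"
proof -
  from mat_fun_spectral[OF assms(2) psd_matD(1)[OF assms]]
  obtain U l where U: "unitary_mat n U" and A: "A = spectral n U l"
    and f: "\<And>f. mat_fun f A = spectral n U (\<lambda>i. f (l i))" by metis
  have "l i \<ge> 0" if "i < n" for i
    using qform_spectral_col[OF U that, of l] psd_matD(2)[OF assms, of "col U i"] A that unitary_carrier[OF U]
    by (simp add: col_carrier_vec)
  then have "A = spectral n U (\<lambda>i. \<bar>l i\<bar>)" "mat_fun f A = spectral n U (\<lambda>i. f \<bar>l i\<bar>)" for f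
    using A f by (auto intro!: spectral_cong)
  then show thesis using that[OF U, of "\<lambda>i. \<bar>l i\<bar>"] by simp
qed

subsection \<open>The trace distance of pure states\<close>

text \<open>Bessel: \<open>w\<close> is completed to a unitary and one term of Parseval's sum is
  kept.\<close>

lemma cinner_le_one:
  assumes v: "v \<in> carrier_vec n" "v \<bullet>c v = 1" and w: "w \<in> carrier_vec n" "w \<bullet>c w = 1"
  shows "(cmod (v \<bullet>c w))\<^sup>2 \<le> 1"
proof -
  obtain W where W: "unitary_mat n W" "col W 0 = w" using unitary_extension[OF w] .
  have "w \<noteq> 0\<^sub>v n" using w by auto
  then have "n > 0" using w(1) by (cases n) auto
  then have "(cmod (v \<bullet>c col W 0))\<^sup>2 \<le> (\<Sum>b<n. (cmod (v \<bullet>c col W b))\<^sup>2)"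
    by (intro member_le_sum) auto
  then show ?thesis using parseval_norm[OF W(1) v(1)] v(2) W(2) by simp
qed

lemma proj_idem:
  assumes "v \<in> carrier_vec n" "v \<bullet>c v = 1"
  shows "proj v * proj v = proj v"
proof -
  have "1 \<cdot>\<^sub>m proj v = proj v" by (rule eq_matI) auto
  then show ?thesis using proj_sandwich[OF one_carrier_mat assms(1)] assms
    by (simp add: left_mult_one_mat[OF proj_carrier[OF assms(1)]])
qed

lemma mtrace_proj: "v \<in> carrier_vec n \<Longrightarrow> mtrace (proj v) = v \<bullet>c v"
  using mtrace_mult_proj[of "1\<^sub>m n" n v] by (simp add: left_mult_one_mat[OF proj_carrier[of v n]])

lemma cinner_proj:
  assumes "v \<in> carrier_vec n" "w \<in> carrier_vec n"
  shows "(proj v *\<^sub>v w) \<bullet>c w = complex_of_real ((cmod (v \<bullet>c w))\<^sup>2)"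
  using hermitian_cinner_real[OF proj_carrier[OF assms(1)] proj_adj assms(2)] qform_proj[OF assms]
    cinner_cmod_commute[OF assms] by simp

text \<open>The eigenvectors of the difference are never computed. Its square \<open>H\<close> acts
  as the scalar \<open>d\<close> on both projections, whence \<open>H * H\<close> is
  \<open>d\<close> times \<open>H\<close> and every eigenvalue is 0 or \<open>d\<close>; the trace
  \<open>2 * d\<close> then fixes the sum of the roots.\<close>

lemma trace_norm_proj_diff_le:
  assumes v: "v \<in> carrier_vec n" "v \<bullet>c v = 1" and w: "w \<in> carrier_vec n" "w \<bullet>c w = 1"
  shows "trace_norm (proj v - proj w) \<le> 2 * sqrt (1 - (cmod (v \<bullet>c w))\<^sup>2)"
proof -
  define P where "P = proj v"
  define Q where "Q = proj w"
  define g where "g = (cmod (v \<bullet>c w))\<^sup>2"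
  define d where "d = 1 - g"
  have d: "d \<ge> 0" using cinner_le_one[OF v w] by (simp add: d_def g_def)
  have P: "P \<in> carrier_mat n n" "adj P = P" "P * P = P" and Q: "Q \<in> carrier_mat n n" "adj Q = Q" "Q * Q = Q"
    using v w by (auto simp: P_def Q_def proj_idem)
  have PQP: "P * (Q * P) = complex_of_real g \<cdot>\<^sub>m P"
    unfolding P_def Q_def g_def using proj_sandwich[OF proj_carrier[OF w(1)] v(1)] cinner_proj[OF w(1) v(1)]
      cinner_cmod_commute[OF w(1) v(1)] by simp
  have QPQ: "Q * (P * Q) = complex_of_real g \<cdot>\<^sub>m Q"
    unfolding P_def Q_def g_def using proj_sandwich[OF proj_carrier[OF v(1)] w(1)] cinner_proj[OF v(1) w(1)] by simp
  have PPQ: "P * (P * Q) = P * Q" and QQP: "Q * (Q * P) = Q * P"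
    using assoc_mult_mat[OF P(1) P(1) Q(1)] assoc_mult_mat[OF Q(1) Q(1) P(1)] P Q by simp_all
  have PQ: "P * Q \<in> carrier_mat n n" and QP: "Q * P \<in> carrier_mat n n" using P Q by auto
  define A where "A = P - Q"
  have A: "A \<in> carrier_mat n n" using P Q by (simp add: A_def minus_carrier_mat)
  have adjA: "adj A = A" unfolding A_def P_def Q_def
    by (rule eq_matI) (use v(1) w(1) in \<open>auto simp: proj_def\<close>)
  define H where "H = A * A"
  have H: "H \<in> carrier_mat n n" "adj H = H" using A adjA by (auto simp: H_def adj_mult[OF A A])
  have Hexp: "H = P - Q * P - (P * Q - Q)"
    unfolding H_def A_def using P Q PQ QP
    by (simp add: minus_mult_distrib_mat[of _ n n _ _ n] mult_minus_distrib_mat[of _ n n _ n] minus_carrier_mat)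
  have HP: "H * P = complex_of_real d \<cdot>\<^sub>m P"
  proof -
    have "H * P = P * P - (Q * P) * P - ((P * Q) * P - Q * P)"
      unfolding Hexp using P Q PQ QP
      by (simp add: minus_mult_distrib_mat[of _ n n _ _ n] minus_carrier_mat)
    also have "\<dots> = P - Q * P - (complex_of_real g \<cdot>\<^sub>m P - Q * P)"
      using P Q by (simp add: assoc_mult_mat[of _ n n _ n _ n] PQP)
    also have "\<dots> = complex_of_real d \<cdot>\<^sub>m P"
      by (rule eq_matI) (simp_all add: carrier_matD[OF P(1)] carrier_matD[OF QP] carrier_matD[OF Q(1)] d_def left_diff_distrib del: index_mult_mat(1))
    finally show ?thesis .
  qed
  have HQ: "H * Q = complex_of_real d \<cdot>\<^sub>m Q"
  proof -
    have "H * Q = P * Q - (Q * P) * Q - ((P * Q) * Q - Q * Q)"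
      unfolding Hexp using P Q PQ QP
      by (simp add: minus_mult_distrib_mat[of _ n n _ _ n] minus_carrier_mat)
    also have "\<dots> = P * Q - complex_of_real g \<cdot>\<^sub>m Q - (P * Q - Q)"
      using P Q by (simp add: assoc_mult_mat[of _ n n _ n _ n] QPQ)
    also have "\<dots> = complex_of_real d \<cdot>\<^sub>m Q"
      by (rule eq_matI) (simp_all add: carrier_matD[OF P(1)] carrier_matD[OF PQ] carrier_matD[OF Q(1)] d_def left_diff_distrib del: index_mult_mat(1))
    finally show ?thesis .
  qed
  have HA: "H * A = complex_of_real d \<cdot>\<^sub>m A"
  proof -
    have "H * A = complex_of_real d \<cdot>\<^sub>m P - complex_of_real d \<cdot>\<^sub>m Q"
      unfolding A_def using H P Q by (simp add: mult_minus_distrib_mat[of _ n n _ n] HP HQ)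
    also have "\<dots> = complex_of_real d \<cdot>\<^sub>m A"
      unfolding A_def by (rule eq_matI) (use P Q in \<open>auto simp: right_diff_distrib\<close>)
    finally show ?thesis .
  qed
  have HH: "H * H = complex_of_real d \<cdot>\<^sub>m H"
  proof -
    have "H * H = (H * A) * A" unfolding H_def using A by (simp add: assoc_mult_mat[of _ n n _ n _ n])
    then show ?thesis unfolding HA using A by (simp add: H_def mult_smult_assoc_mat[of _ n n _ n])
  qed
  have "mtrace (Q * P) = complex_of_real g" "mtrace (P * Q) = complex_of_real g"
    using mtrace_mult_proj[OF Q(1) v(1)] mtrace_mult_proj[OF P(1) w(1)]
      cinner_proj[OF w(1) v(1)] cinner_proj[OF v(1) w(1)] cinner_cmod_commute[OF w(1) v(1)]
    by (simp_all add: P_def Q_def g_def)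
  moreover have "mtrace P = 1" "mtrace Q = 1" using v w by (simp_all add: P_def Q_def mtrace_proj)
  ultimately have trH: "Re (mtrace H) = 2 * d"
    unfolding Hexp using P Q PQ QP by (simp add: mtrace_minus[of _ n] minus_carrier_mat d_def)
  from mat_fun_spectral[OF H] obtain U l where U: "unitary_mat n U" and HU: "H = spectral n U l"
    and f: "\<And>f. mat_fun f H = spectral n U (\<lambda>i. f (l i))" by metis
  note Uc = unitary_carrier[OF U]
  have tr: "Re (mtrace (spectral n U h)) = (\<Sum>i<n. h i)" for h
    unfolding sum_qform_basis[OF spectral_carrier[OF Uc] U, symmetric]
    by (intro sum.cong refl) (simp add: qform_spectral_col[OF U])
  have l: "l i * l i = d * l i" if i: "i < n" for i
  proof -
    have ci: "col U i \<in> carrier_vec n" using Uc i by simp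
    have "l i * l i = qform (H * H) (col U i)"
      unfolding HU spectral_mult[OF U] by (rule qform_spectral_col[OF U i, symmetric])
    also have "\<dots> = d * qform H (col U i)" unfolding HH by (rule qform_smult[OF H(1) ci])
    also have "qform H (col U i) = l i" unfolding HU by (rule qform_spectral_col[OF U i])
    finally show ?thesis .
  qed
  have "(\<Sum>i<n. sqrt (l i)) = 2 * sqrt d"
  proof (cases "d = 0")
    case True
    then have "l i = 0" if "i < n" for i using l[OF that] by simp
    then show ?thesis using True by simp
  next
    case False
    then have dp: "d > 0" using d by simp
    \<comment> \<open>On the two possible eigenvalues 0 and \<open>d\<close> the square root is
      linear, so the trace of \<open>H\<close> is all that is needed.\<close>
    have "sqrt (l i) = l i / sqrt d" if i: "i < n" for i
    proof (cases "l i = 0")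
      case False
      then have "l i = d" using l[OF i] by simp
      then show ?thesis using dp by (simp add: real_div_sqrt)
    qed simp
    then have "(\<Sum>i<n. sqrt (l i)) = (\<Sum>i<n. l i) / sqrt d" by (simp add: sum_divide_distrib)
    also have "(\<Sum>i<n. l i) = 2 * d" using trH tr[of l] by (simp add: HU)
    finally have "(\<Sum>i<n. sqrt (l i)) = 2 * (d / sqrt d)" by simp
    then show ?thesis using dp by (simp only: real_div_sqrt less_imp_le)
  qed
  moreover have "trace_norm A = (\<Sum>i<n. sqrt (l i))"
    unfolding trace_norm_def H_def[symmetric] f by (rule tr)
  ultimately show ?thesis by (simp add: A_def P_def Q_def d_def g_def)
qed

subsection \<open>Partial traces and purifications\<close>

lemma pair_index_less: "(i::nat) < n \<Longrightarrow> k < m \<Longrightarrow> i * m + k < n * m"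
proof -
  assume "i < n" "k < m"
  then have "i * m + k < Suc i * m" by simp
  also have "\<dots> \<le> n * m" using \<open>i < n\<close> by (intro mult_le_mono1) simp
  finally show ?thesis .
qed

lemma sum_pair_index: "(\<Sum>x<n * m. f x) = (\<Sum>i<n. \<Sum>k<m. f (i * m + k :: nat))"
proof -
  have "(\<Sum>x\<in>{i * m..<i * m + m}. f x) = (\<Sum>k<m. f (i * m + k))" for i
    using sum.shift_bounds_nat_ivl[of f 0 "i * m" m] by (simp add: lessThan_atLeast0 add.commute)
  then show ?thesis unfolding sum.nat_group[of f m n, symmetric] by simp
qed

lemma ptrace2_carrier [simp]: "ptrace2 n m A \<in> carrier_mat n n"
  by (simp add: ptrace2_def)

lemma ptrace2_proj_index:
  assumes v: "v \<in> carrier_vec (n * m)" and ij: "i < n" "j < n"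
  shows "ptrace2 n m (proj v) $$ (i,j) = (\<Sum>k<m. v $ (i * m + k) * cnj (v $ (j * m + k)))"
  unfolding ptrace2_def using ij by (simp add: proj_index[OF v] pair_index_less)

lemma mtrace_ptrace2_proj:
  assumes v: "v \<in> carrier_vec (n * m)"
  shows "mtrace (ptrace2 n m (proj v)) = v \<bullet>c v"
  unfolding mtrace_sum[OF ptrace2_carrier] cinner_sum[OF v] sum_pair_index
  by (intro sum.cong refl) (simp add: ptrace2_proj_index[OF v])

text \<open>Unit norm follows from trace one, since the partial trace preserves the trace.\<close>

lemma purificationI:
  assumes "v \<in> carrier_vec (n * m)" "mtrace \<rho> = 1" "ptrace2 n m (proj v) = \<rho>"
  shows "purification n m \<rho> v"
  using assms mtrace_ptrace2_proj[OF assms(1)] by (simp add: purification_def pure_state_def)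

lemma purification_exists:
  assumes \<rho>: "density_mat n \<rho>" and nm: "n \<le> m"
  obtains v where "purification n m \<rho> v"
proof -
  have c: "\<rho> \<in> carrier_mat n n" and psd: "psd_mat \<rho>" and tr: "mtrace \<rho> = 1"
    using \<rho> by (auto simp: density_mat_def)
  obtain U l where U: "unitary_mat n U" and l: "\<And>i. l i \<ge> 0" and \<rho>U: "\<rho> = spectral n U l"
    using psd_spectral[OF psd c] by metis
  note Uc = unitary_carrier[OF U]
  \<comment> \<open>Schmidt form: the sum over \<open>k < n\<close> of \<open>sqrt (l k)\<close>
    times \<open>col U k\<close> tensored with the basis vector \<open>k\<close>. The second factor
    has room for it because \<open>n \<le> m\<close>; its surplus coordinates are 0.\<close>
  define v where "v = vec (n * m) (\<lambda>x. if x mod m < n then complex_of_real (sqrt (l (x mod m))) * U $$ (x div m, x mod m) else 0)"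
  have v: "v \<in> carrier_vec (n * m)" by (simp add: v_def)
  have vi: "v $ (i * m + k) = (if k < n then complex_of_real (sqrt (l k)) * U $$ (i,k) else 0)" if "i < n" "k < m" for i k
    using that by (simp add: v_def pair_index_less)
  have "ptrace2 n m (proj v) $$ (i,j) = \<rho> $$ (i,j)" if ij: "i < n" "j < n" for i j
  proof -
    have "ptrace2 n m (proj v) $$ (i,j) = (\<Sum>k<m. if k < n then complex_of_real (l k) * U $$ (i,k) * cnj (U $$ (j,k)) else 0)"
      unfolding ptrace2_proj_index[OF v ij]
    proof (intro sum.cong refl)
      fix k assume k: "k \<in> {..<m}"
      have "complex_of_real (sqrt (l k)) * complex_of_real (sqrt (l k)) = complex_of_real (l k)"
        unfolding of_real_mult[symmetric] using l[of k] by simp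
      then show "v $ (i * m + k) * cnj (v $ (j * m + k)) = (if k < n then complex_of_real (l k) * U $$ (i,k) * cnj (U $$ (j,k)) else 0)"
        using k vi[OF ij(1), of k] vi[OF ij(2), of k] by (auto simp: mult_ac)
    qed
    also have "\<dots> = (\<Sum>k<n. if k < n then complex_of_real (l k) * U $$ (i,k) * cnj (U $$ (j,k)) else 0)"
      using nm by (intro sum.mono_neutral_right) auto
    also have "\<dots> = \<rho> $$ (i,j)" unfolding \<rho>U spectral_index[OF Uc ij] by (intro sum.cong) auto
    finally show ?thesis .
  qed
  then have "ptrace2 n m (proj v) = \<rho>"
    using c carrier_matD[OF ptrace2_carrier[of n m "proj v"]] by (intro eq_matI) auto
  then show thesis using that purificationI[OF v tr] by simp
qed

text \<open>The operator \<open>G \<otimes> 1\<close> applied to \<open>v\<close>: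
  \<open>x div m\<close> is the coordinate in the first factor and \<open>x mod m\<close> the one in
  the second.\<close>

definition local_apply :: "nat \<Rightarrow> nat \<Rightarrow> complex mat \<Rightarrow> complex vec \<Rightarrow> complex vec" where
  "local_apply n m G v = vec (n * m) (\<lambda>x. \<Sum>i<n. G $$ (x div m, i) * v $ (i * m + x mod m))"

lemma local_apply_carrier [simp]: "local_apply n m G v \<in> carrier_vec (n * m)"
  by (simp add: local_apply_def)

lemma local_apply_index:
  "i < n \<Longrightarrow> k < m \<Longrightarrow> local_apply n m G v $ (i * m + k) = (\<Sum>j<n. G $$ (i,j) * v $ (j * m + k))"
  by (simp add: local_apply_def pair_index_less)

text \<open>Links the vector to the minimiser: for Hermitian \<open>G\<close> this marginal is the
  sandwiched state that the first-order condition bounds.\<close>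

lemma ptrace2_local_apply:
  assumes G: "G \<in> carrier_mat n n" and v: "v \<in> carrier_vec (n * m)"
  shows "ptrace2 n m (proj (local_apply n m G v)) = G * (ptrace2 n m (proj v) * adj G)"
proof (rule eq_matI)
  let ?\<rho> = "ptrace2 n m (proj v)"
  have R: "?\<rho> * adj G \<in> carrier_mat n n" using G by simp
  fix i j assume "i < dim_row (G * (?\<rho> * adj G))" "j < dim_col (G * (?\<rho> * adj G))"
  then have ij: "i < n" "j < n" using G by auto
  have "(G * (?\<rho> * adj G)) $$ (i,j) = (\<Sum>a<n. G $$ (i,a) * (\<Sum>b<n. (\<Sum>k<m. v $ (a * m + k) * cnj (v $ (b * m + k))) * cnj (G $$ (j,b))))"
    unfolding mult_index[OF G R ij]
  proof (intro sum.cong refl)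
    fix a assume "a \<in> {..<n}"
    then have a: "a < n" by simp
    have "(?\<rho> * adj G) $$ (a,j) = (\<Sum>b<n. (\<Sum>k<m. v $ (a * m + k) * cnj (v $ (b * m + k))) * cnj (G $$ (j,b)))"
      unfolding mult_index[OF ptrace2_carrier adj_carrier[OF G] a ij(2)]
      using G ij a by (intro sum.cong refl) (simp add: ptrace2_proj_index[OF v])
    then show "G $$ (i,a) * (?\<rho> * adj G) $$ (a,j) = G $$ (i,a) * (\<Sum>b<n. (\<Sum>k<m. v $ (a * m + k) * cnj (v $ (b * m + k))) * cnj (G $$ (j,b)))"
      by simp
  qed
  also have "\<dots> = (\<Sum>a<n. \<Sum>b<n. \<Sum>k<m. (G $$ (i,a) * v $ (a * m + k)) * cnj (G $$ (j,b) * v $ (b * m + k)))"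
    by (simp add: sum_distrib_left sum_distrib_right mult_ac)
  also have "\<dots> = (\<Sum>a<n. \<Sum>k<m. \<Sum>b<n. (G $$ (i,a) * v $ (a * m + k)) * cnj (G $$ (j,b) * v $ (b * m + k)))"
    by (intro sum.cong refl sum.swap)
  also have "\<dots> = (\<Sum>k<m. \<Sum>a<n. \<Sum>b<n. (G $$ (i,a) * v $ (a * m + k)) * cnj (G $$ (j,b) * v $ (b * m + k)))"
    by (rule sum.swap)
  also have "\<dots> = (\<Sum>k<m. (\<Sum>a<n. G $$ (i,a) * v $ (a * m + k)) * cnj (\<Sum>b<n. G $$ (j,b) * v $ (b * m + k)))"
    unfolding cnj_sum sum_product ..
  also have "\<dots> = ptrace2 n m (proj (local_apply n m G v)) $$ (i,j)"
    unfolding ptrace2_proj_index[OF local_apply_carrier ij]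
    using ij by (intro sum.cong refl) (simp add: local_apply_index)
  finally show "ptrace2 n m (proj (local_apply n m G v)) $$ (i,j) = (G * (?\<rho> * adj G)) $$ (i,j)" by simp
qed (use G carrier_matD[OF ptrace2_carrier] in auto)

lemma local_apply_cinner:
  assumes G: "G \<in> carrier_mat n n" and v: "v \<in> carrier_vec (n * m)"
  shows "local_apply n m G v \<bullet>c v = mtrace (G * ptrace2 n m (proj v))"
proof -
  have "local_apply n m G v \<bullet>c v = (\<Sum>i<n. \<Sum>k<m. \<Sum>j<n. G $$ (i,j) * (v $ (j * m + k) * cnj (v $ (i * m + k))))"
    unfolding cinner_sum[OF v] sum_pair_index
    by (intro sum.cong refl) (simp add: local_apply_index sum_distrib_right mult.assoc)
  also have "\<dots> = (\<Sum>i<n. \<Sum>j<n. \<Sum>k<m. G $$ (i,j) * (v $ (j * m + k) * cnj (v $ (i * m + k))))"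
    by (intro sum.cong refl sum.swap)
  also have "\<dots> = mtrace (G * ptrace2 n m (proj v))"
    unfolding mtrace_mult[OF G ptrace2_carrier]
    by (intro sum.cong refl) (simp add: ptrace2_proj_index[OF v] sum_distrib_left)
  finally show ?thesis .
qed

section \<open>Scaled and flagged vectors\<close>

lemma ptrace2_proj_smult:
  assumes v: "v \<in> carrier_vec (n * m)"
  shows "ptrace2 n m (proj (complex_of_real a \<cdot>\<^sub>v v)) = complex_of_real (a\<^sup>2) \<cdot>\<^sub>m ptrace2 n m (proj v)"
proof (rule eq_matI)
  have av: "complex_of_real a \<cdot>\<^sub>v v \<in> carrier_vec (n * m)" using v by simp
  fix i j assume "i < dim_row (complex_of_real (a\<^sup>2) \<cdot>\<^sub>m ptrace2 n m (proj v))"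
    "j < dim_col (complex_of_real (a\<^sup>2) \<cdot>\<^sub>m ptrace2 n m (proj v))"
  then have ij: "i < n" "j < n" by (auto simp: ptrace2_def)
  have "ptrace2 n m (proj (complex_of_real a \<cdot>\<^sub>v v)) $$ (i,j) =
      (\<Sum>k<m. complex_of_real (a\<^sup>2) * (v $ (i * m + k) * cnj (v $ (j * m + k))))"
    unfolding ptrace2_proj_index[OF av ij]
  proof (intro sum.cong refl)
    fix k assume "k \<in> {..<m}"
    then have "i * m + k < dim_vec v" "j * m + k < dim_vec v"
      using carrier_vecD[OF v] ij by (auto intro: pair_index_less)
    then show "(complex_of_real a \<cdot>\<^sub>v v) $ (i * m + k) * cnj ((complex_of_real a \<cdot>\<^sub>v v) $ (j * m + k)) =
        complex_of_real (a\<^sup>2) * (v $ (i * m + k) * cnj (v $ (j * m + k)))"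
      by (simp add: power2_eq_square mult_ac)
  qed
  then show "ptrace2 n m (proj (complex_of_real a \<cdot>\<^sub>v v)) $$ (i,j) = (complex_of_real (a\<^sup>2) \<cdot>\<^sub>m ptrace2 n m (proj v)) $$ (i,j)"
    using ij carrier_matD[OF ptrace2_carrier[of n m "proj v"]] by (simp add: ptrace2_proj_index[OF v] sum_distrib_left)
qed (auto simp: ptrace2_def)

lemma vec_kron_unit:
  assumes "v \<in> carrier_vec N"
  shows "vec_kron v (unit_vec 2 b) \<in> carrier_vec (N * 2)"
    "\<lbrakk>x < N; c < 2\<rbrakk> \<Longrightarrow> vec_kron v (unit_vec 2 b) $ (x * 2 + c) = (if c = b then v $ x else 0)"
  using assms pair_index_less[of x N c 2] by (auto simp: vec_kron_def unit_vec_def)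

text \<open>The two flag states are orthogonal, so no cross terms survive. The flag is traced out
  together with the second factor, which regroups \<open>n * m * 2\<close> as
  \<open>n * (m * 2)\<close>.\<close>

lemma ptrace2_flagged:
  fixes a b :: real
  assumes v: "v \<in> carrier_vec (n * m)" and w: "w \<in> carrier_vec (n * m)"
  defines "u \<equiv> complex_of_real a \<cdot>\<^sub>v vec_kron v (unit_vec 2 1) + complex_of_real b \<cdot>\<^sub>v vec_kron w (unit_vec 2 0)"
  shows "u \<in> carrier_vec (n * (m * 2))"
    "ptrace2 n (m * 2) (proj u) = complex_of_real (a\<^sup>2) \<cdot>\<^sub>m ptrace2 n m (proj v) + complex_of_real (b\<^sup>2) \<cdot>\<^sub>m ptrace2 n m (proj w)"
proof -
  have "u \<in> carrier_vec (n * m * 2)" unfolding u_def using vec_kron_unit(1)[OF v] vec_kron_unit(1)[OF w] by simp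
  then show u: "u \<in> carrier_vec (n * (m * 2))" by (simp add: mult.assoc)
  have ui: "u $ (i * (m * 2) + (k * 2 + c)) = (if c = 1 then complex_of_real a * v $ (i * m + k) else complex_of_real b * w $ (i * m + k))"
    if "i < n" "k < m" "c < 2" for i k c
  proof -
    have x: "i * m + k < n * m" using that by (simp add: pair_index_less)
    \<comment> \<open>One position read in two ways: offset \<open>k * 2 + c\<close> in a block of
      length \<open>m * 2\<close>, or flag \<open>c\<close> behind the joint index
      \<open>i * m + k\<close>.\<close>
    have eq: "i * (m * 2) + (k * 2 + c) = (i * m + k) * 2 + c" by (simp add: algebra_simps)
    have "(i * m + k) * 2 + c < n * m * 2" using x that(3) by (rule pair_index_less)
    then have "u $ ((i * m + k) * 2 + c) = complex_of_real a * vec_kron v (unit_vec 2 1) $ ((i * m + k) * 2 + c)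
        + complex_of_real b * vec_kron w (unit_vec 2 0) $ ((i * m + k) * 2 + c)"
      unfolding u_def using carrier_vecD[OF vec_kron_unit(1)[OF v]] carrier_vecD[OF vec_kron_unit(1)[OF w]]
      by (simp del: mult_Suc_right)
    then show ?thesis
      unfolding eq vec_kron_unit(2)[OF v x that(3)] vec_kron_unit(2)[OF w x that(3)] using that(3) by auto
  qed
  show "ptrace2 n (m * 2) (proj u) = complex_of_real (a\<^sup>2) \<cdot>\<^sub>m ptrace2 n m (proj v) + complex_of_real (b\<^sup>2) \<cdot>\<^sub>m ptrace2 n m (proj w)"
  proof (rule eq_matI)
    fix i j assume "i < dim_row (complex_of_real (a\<^sup>2) \<cdot>\<^sub>m ptrace2 n m (proj v) + complex_of_real (b\<^sup>2) \<cdot>\<^sub>m ptrace2 n m (proj w))"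
      "j < dim_col (complex_of_real (a\<^sup>2) \<cdot>\<^sub>m ptrace2 n m (proj v) + complex_of_real (b\<^sup>2) \<cdot>\<^sub>m ptrace2 n m (proj w))"
    then have ij: "i < n" "j < n" by (auto simp: ptrace2_def)
    have "ptrace2 n (m * 2) (proj u) $$ (i,j) = (\<Sum>k<m. \<Sum>c<2. u $ (i * (m * 2) + (k * 2 + c)) * cnj (u $ (j * (m * 2) + (k * 2 + c))))"
      unfolding ptrace2_proj_index[OF u ij] sum_pair_index ..
    also have "\<dots> = (\<Sum>k<m. complex_of_real (a\<^sup>2) * (v $ (i * m + k) * cnj (v $ (j * m + k))) + complex_of_real (b\<^sup>2) * (w $ (i * m + k) * cnj (w $ (j * m + k))))"
    proof (intro sum.cong refl)
      fix k assume "k \<in> {..<m}"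
      then have k: "k < m" by simp
      have two: "{..<2::nat} = {0, 1}" by auto
      show "(\<Sum>c<2. u $ (i * (m * 2) + (k * 2 + c)) * cnj (u $ (j * (m * 2) + (k * 2 + c)))) =
          complex_of_real (a\<^sup>2) * (v $ (i * m + k) * cnj (v $ (j * m + k))) + complex_of_real (b\<^sup>2) * (w $ (i * m + k) * cnj (w $ (j * m + k)))"
        unfolding two using ui[OF ij(1) k, of 0] ui[OF ij(1) k, of 1] ui[OF ij(2) k, of 0] ui[OF ij(2) k, of 1]
        by (simp add: power2_eq_square mult_ac)
    qed
    also have "\<dots> = (complex_of_real (a\<^sup>2) \<cdot>\<^sub>m ptrace2 n m (proj v) + complex_of_real (b\<^sup>2) \<cdot>\<^sub>m ptrace2 n m (proj w)) $$ (i,j)"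
      using ij carrier_matD[OF ptrace2_carrier[of n m "proj v"]] carrier_matD[OF ptrace2_carrier[of n m "proj w"]]
      by (simp add: ptrace2_proj_index[OF v] ptrace2_proj_index[OF w] sum.distrib sum_distrib_left)
    finally show "ptrace2 n (m * 2) (proj u) $$ (i,j) = (complex_of_real (a\<^sup>2) \<cdot>\<^sub>m ptrace2 n m (proj v) + complex_of_real (b\<^sup>2) \<cdot>\<^sub>m ptrace2 n m (proj w)) $$ (i,j)" .
  qed (auto simp: ptrace2_def)
qed

lemma ptrace2_proj_adj:
  assumes v: "v \<in> carrier_vec (n * m)"
  shows "adj (ptrace2 n m (proj v)) = ptrace2 n m (proj v)"
proof (rule eq_matI)
  note c = carrier_matD[OF ptrace2_carrier[of n m "proj v"]]
  fix i j assume "i < dim_row (ptrace2 n m (proj v))" "j < dim_col (ptrace2 n m (proj v))"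
  then have ij: "i < n" "j < n" using c by auto
  show "adj (ptrace2 n m (proj v)) $$ (i,j) = ptrace2 n m (proj v) $$ (i,j)"
    using ij c by (simp add: ptrace2_proj_index[OF v] mult.commute)
qed (use carrier_matD[OF ptrace2_carrier[of n m "proj v"]] in auto)

text \<open>\<open>le\<close> is the positivity of \<open>\<sigma>\<close> minus \<open>c\<close>
  times the marginal of \<open>\<phi>\<close>, and \<open>c < 1\<close> allows division by its trace
  \<open>1 - c\<close>. Mixing the two states back with weights \<open>c\<close> and
  \<open>1 - c\<close> returns \<open>\<sigma>\<close>.\<close>

lemma flagged_purification:
  assumes \<sigma>: "density_mat n \<sigma>" and nm: "n \<le> m" and \<phi>: "pure_state (n * m) \<phi>"
    and c: "0 \<le> c" "c < 1"
    and le: "\<And>v. v \<in> carrier_vec n \<Longrightarrow> c * qform (ptrace2 n m (proj \<phi>)) v \<le> qform \<sigma> v"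
  shows "\<exists>\<theta> \<zeta>. pure_state (n * m) \<theta> \<and> purification n (m * 2) \<sigma> \<zeta> \<and>
    \<zeta> = complex_of_real (sqrt c) \<cdot>\<^sub>v vec_kron \<phi> (unit_vec 2 1) + complex_of_real (sqrt (1 - c)) \<cdot>\<^sub>v vec_kron \<theta> (unit_vec 2 0)"
proof -
  have S: "\<sigma> \<in> carrier_mat n n" and psd: "psd_mat \<sigma>" and tr: "mtrace \<sigma> = 1"
    using \<sigma> by (auto simp: density_mat_def)
  have \<phi>c: "\<phi> \<in> carrier_vec (n * m)" and \<phi>1: "\<phi> \<bullet>c \<phi> = 1" using \<phi> by (auto simp: pure_state_def)
  define R where "R = ptrace2 n m (proj \<phi>)"
  have R: "R \<in> carrier_mat n n" "adj R = R" "mtrace R = 1"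
    using mtrace_ptrace2_proj[OF \<phi>c] \<phi>1 ptrace2_proj_adj[OF \<phi>c] by (auto simp: R_def)
  define d where "d = 1 / (1 - c)"
  have d: "d > 0" "d * (1 - c) = 1" using c by (auto simp: d_def)
  define T where "T = complex_of_real d \<cdot>\<^sub>m (\<sigma> + complex_of_real (- c) \<cdot>\<^sub>m R)"
  have I: "\<sigma> + complex_of_real (- c) \<cdot>\<^sub>m R \<in> carrier_mat n n" using R by simp
  have T: "T \<in> carrier_mat n n" using I by (simp add: T_def)
  have "density_mat n T" unfolding density_mat_def
  proof (intro conjI psd_matI[OF T] T)
    show "adj T = T" unfolding T_def using S R psd_matD(1)[OF psd S]
      by (simp only: adj_smult_real adj_add[OF S smult_carrier_mat[OF R(1)]])
    fix v :: "complex vec" assume v: "v \<in> carrier_vec n"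
    have "qform T v = d * (qform \<sigma> v + (- c) * qform R v)"
      unfolding T_def qform_smult[OF I v] qform_add[OF S smult_carrier_mat[OF R(1)] v] qform_smult[OF R(1) v] ..
    then show "0 \<le> qform T v" using le[OF v] d by (simp add: R_def)
  next
    have "mtrace T = complex_of_real d * (1 + complex_of_real (- c) * 1)"
      unfolding T_def mtrace_smult[OF I] mtrace_add[OF S smult_carrier_mat[OF R(1)]] mtrace_smult[OF R(1)] tr R(3) ..
    also have "\<dots> = complex_of_real (d * (1 - c))" by simp
    finally show "mtrace T = 1" using d by simp
  qed
  then obtain \<theta> where \<theta>: "purification n m T \<theta>" using purification_exists[OF _ nm] by metis
  have \<theta>c: "\<theta> \<in> carrier_vec (n * m)" and \<theta>p: "ptrace2 n m (proj \<theta>) = T"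
    using \<theta> by (auto simp: purification_def pure_state_def)
  define \<zeta> where "\<zeta> = complex_of_real (sqrt c) \<cdot>\<^sub>v vec_kron \<phi> (unit_vec 2 1) + complex_of_real (sqrt (1 - c)) \<cdot>\<^sub>v vec_kron \<theta> (unit_vec 2 0)"
  have "ptrace2 n (m * 2) (proj \<zeta>) = complex_of_real ((sqrt c)\<^sup>2) \<cdot>\<^sub>m R + complex_of_real ((sqrt (1 - c))\<^sup>2) \<cdot>\<^sub>m T"
    unfolding \<zeta>_def ptrace2_flagged(2)[OF \<phi>c \<theta>c] \<theta>p R_def ..
  also have "\<dots> = complex_of_real c \<cdot>\<^sub>m R + complex_of_real (1 - c) \<cdot>\<^sub>m T" using c by simp
  also have "\<dots> = \<sigma>"
  proof (rule eq_matI)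
    fix i j assume "i < dim_row \<sigma>" "j < dim_col \<sigma>"
    then have ij: "i < n" "j < n" using S by auto
    have cancel: "complex_of_real (1 - c) * (complex_of_real d * x) = x" for x
      unfolding mult.assoc[symmetric] of_real_mult[symmetric] using d(2) by (simp add: mult.commute)
    have Tij: "T $$ (i,j) = complex_of_real d * (\<sigma> $$ (i,j) - complex_of_real c * R $$ (i,j))"
      unfolding T_def using ij S R by simp
    have "complex_of_real (1 - c) * T $$ (i,j) = \<sigma> $$ (i,j) - complex_of_real c * R $$ (i,j)"
      unfolding Tij by (rule cancel)
    then show "(complex_of_real c \<cdot>\<^sub>m R + complex_of_real (1 - c) \<cdot>\<^sub>m T) $$ (i,j) = \<sigma> $$ (i,j)"
      using ij T R by (simp del: of_real_diff)
  qed (use S R T in auto)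
  finally have "purification n (m * 2) \<sigma> \<zeta>"
    using ptrace2_flagged(1)[OF \<phi>c \<theta>c] by (intro purificationI tr) (simp_all add: \<zeta>_def)
  then show ?thesis using \<theta> \<zeta>_def by (auto simp: purification_def)
qed

lemma qform_sandwich:
  assumes G: "G \<in> carrier_mat n n" and A: "A \<in> carrier_mat n n" and v: "v \<in> carrier_vec n"
  shows "qform (G * (A * adj G)) v = qform A (adj G *\<^sub>v v)"
proof -
  have w: "adj G *\<^sub>v v \<in> carrier_vec n" using mult_mat_vec_carrier[OF adj_carrier[OF G] v] .
  have Aw: "A *\<^sub>v (adj G *\<^sub>v v) \<in> carrier_vec n" using mult_mat_vec_carrier[OF A w] .
  have "(G * (A * adj G)) *\<^sub>v v = G *\<^sub>v (A *\<^sub>v (adj G *\<^sub>v v))"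
    using G A v by (simp add: assoc_mult_mat_vec[of _ n n _ n])
  then show ?thesis using cinner_adj[OF G Aw v] by (simp add: qform_def)
qed

lemma hermitian_mtrace_spectral:
  assumes A: "A \<in> carrier_mat n n" "adj A = A" and U: "U \<in> carrier_mat n n"
  shows "mtrace (A * spectral n U f) = complex_of_real (\<Sum>i<n. f i * qform A (col U i))"
  unfolding mtrace_mult_spectral[OF A(1) U] of_real_sum of_real_mult
  using U by (intro sum.cong refl) (simp add: hermitian_cinner_real[OF A])

subsection \<open>The substate vector\<close>

lemma substate_vector:
  assumes \<rho>: "density_mat n \<rho>" and \<sigma>: "density_mat n \<sigma>" and r: "r > 1"
    and \<psi>: "purification n m \<rho> \<psi>"
    and kernel: "\<And>v. v \<in> carrier_vec n \<Longrightarrow> \<sigma> *\<^sub>v v = 0\<^sub>v n \<Longrightarrow> \<rho> *\<^sub>v v = 0\<^sub>v n"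
    and k_def: "k = Re (mtrace (\<rho> * (mat_fun log2_supp \<rho> - mat_fun log2_supp \<sigma>)))"
    and c_def: "c = (r - 1) / (r * 2 powr (r * kprime k))"
  shows "0 \<le> c \<and> c < 1 \<and> (\<exists>\<phi>. pure_state (n * m) \<phi> \<and> 1 - 1 / r \<le> (cmod (\<psi> \<bullet>c \<phi>))\<^sup>2 \<and>
      (\<forall>v \<in> carrier_vec n. c * qform (ptrace2 n m (proj \<phi>)) v \<le> qform \<sigma> v))"
proof -
  have Rc: "\<rho> \<in> carrier_mat n n" and Rp: "psd_mat \<rho>" and Rt: "mtrace \<rho> = 1"
    and Sc: "\<sigma> \<in> carrier_mat n n" and Sp: "psd_mat \<sigma>" and St: "mtrace \<sigma> = 1"
    using \<rho> \<sigma> by (auto simp: density_mat_def)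
  note Rh = psd_matD(1)[OF Rp Rc]
  have \<psi>c: "\<psi> \<in> carrier_vec (n * m)" and \<psi>1: "\<psi> \<bullet>c \<psi> = 1" and \<psi>p: "ptrace2 n m (proj \<psi>) = \<rho>"
    using \<psi> by (auto simp: purification_def pure_state_def)
  obtain U l where U0: "unitary_mat n U" "\<And>i. l i \<ge> 0" "\<rho> = spectral n U l"
    and fU: "\<And>f. mat_fun f \<rho> = spectral n U (\<lambda>i. f (l i))"
    using psd_mat_fun_spectral[OF Rp Rc] by metis
  obtain V s where V0: "unitary_mat n V" "\<And>i. s i \<ge> 0" "\<sigma> = spectral n V s"
    and fV: "\<And>f. mat_fun f \<sigma> = spectral n V (\<lambda>i. f (s i))"
    using psd_mat_fun_spectral[OF Sp Sc] by metis
  interpret state_pair n U V l s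
    using U0 V0 kernel by unfold_locales auto
  define L where "L = 2 powr (r * kprime k)"
  have L: "L > 0" by (simp add: L_def)
  \<comment> \<open>The domination constant: it bounds the eigenvalues in the search for a minimum
    and makes \<open>q i\<close> positive wherever \<open>p i\<close> is.\<close>
  define M where "M = (\<Sum>a<n. l a * (\<Sum>b<n. overlap a b / s b))"
  have M: "M \<ge> 0" unfolding M_def overlap_def using U0(2) V0(2)
    by (intro sum_nonneg mult_nonneg_nonneg divide_nonneg_nonneg) auto
  obtain E z where E: "unitary_mat n E" and z: "\<And>i. 0 \<le> z i" and
    min: "\<And>U' z'. unitary_mat n U' \<Longrightarrow> (\<And>i. i < n \<Longrightarrow> 0 \<le> z' i) \<Longrightarrow> cost n \<rho> \<sigma> L E z \<le> cost n \<rho> \<sigma> L U' z'"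
  proof (rule cost_minimizer[OF Rc Sc L M])
    show "0 \<le> qform \<rho> v \<and> 0 \<le> qform \<sigma> v \<and> qform \<rho> v \<le> M * qform \<sigma> v" if "v \<in> carrier_vec n" for v
      using psd_matD(2)[OF Rp Rc that] psd_matD(2)[OF Sp Sc that] dominated[OF that]
      by (simp add: U0(3) V0(3) M_def)
  qed blast
  note Ec = unitary_carrier[OF E]
  define p where "p i = qform \<rho> (col E i)" for i
  define q where "q i = qform \<sigma> (col E i)" for i
  have colE: "col E i \<in> carrier_vec n" if "i < n" for i using Ec that by simp
  have p0: "0 \<le> p i" and q0: "0 \<le> q i" and pq: "p i \<le> M * q i" if "i < n" for i
    using psd_matD(2)[OF Rp Rc colE[OF that]] psd_matD(2)[OF Sp Sc colE[OF that]] dominated[OF colE[OF that]]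
    by (simp_all add: p_def q_def M_def U0(3)[symmetric] V0(3)[symmetric])
  have p1: "(\<Sum>i<n. p i) = 1" and q1: "(\<Sum>i<n. q i) = 1"
    using sum_qform_basis[OF Rc E] sum_qform_basis[OF Sc E] Rt St by (simp_all add: p_def q_def)
  have abs: "0 < q i" if "i < n" "0 < p i" for i
    using pq[OF that(1)] q0[OF that(1)] that(2) by (cases "q i = 0") auto
  have k: "k = (\<Sum>a<n. \<Sum>b<n. l a * overlap a b * (log2_supp (l a) - log2_supp (s b)))"
    unfolding k_def fU fV by (subst U0(3)) (rule relative_entropy_eq)
  have ent: "(\<Sum>i\<in>{i. i < n \<and> 0 < p i}. p i * ln (p i / q i)) \<le> ln 2 * k"
    unfolding k p_def q_def U0(3) V0(3) by (rule measured_relative_entropy_le[OF E])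
  have k0: "0 \<le> k" and bad: "(\<Sum>i\<in>{i. i < n \<and> p i > L * q i}. p i) \<le> 1 / r"
    unfolding L_def by (rule bad_mass_le[OF p0 p1 q0 q1 abs ent r]; assumption)+
  have "log 2 (k + 2) \<ge> 0" using k0 by (simp add: zero_le_log_cancel_iff)
  then have kp: "kprime k \<ge> 0" using k0 unfolding kprime_def by (simp add: add_nonneg_nonneg)
  have L1: "L \<ge> 1" unfolding L_def using kp r by (simp add: ge_one_powr_ge_zero)
  \<comment> \<open>Normalising by \<open>N\<close> enlarges the marginal by at most
    \<open>1 / (1 - 1 / r)\<close>, which the factor \<open>(r - 1) / r\<close> of \<open>c\<close>
    offsets exactly.\<close>
  have cL: "c * L = 1 - 1 / r" using r L by (simp add: c_def L_def[symmetric] field_simps)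
  have c0: "0 \<le> c" using r by (simp add: c_def)
  have "c * 1 \<le> c * L" using L1 c0 by (intro mult_left_mono) auto
  moreover have "c * L < 1" using cL r by simp
  ultimately have c1: "c < 1" by simp
  define G where "G = spectral n E (\<lambda>i. 1 / (1 + z i))"
  have G: "G \<in> carrier_mat n n" "adj G = G" using Ec by (auto simp: G_def)
  \<comment> \<open>\<open>N\<close> and \<open>a\<close> are the traces of
    \<open>\<rho> G G\<close> and \<open>\<rho> G\<close>: the squared norm of the unnormalised
    vector and its inner product with \<open>\<psi>\<close>.\<close>
  define N where "N = (\<Sum>i<n. 1 / (1 + z i) * (1 / (1 + z i)) * p i)"
  define a where "a = (\<Sum>i<n. 1 / (1 + z i) * p i)"
  have zpos: "0 < 1 / (1 + z i)" "1 / (1 + z i) \<le> 1" for i using z[of i] by auto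
  have Na: "N \<le> a" unfolding N_def a_def
  proof (rule sum_mono)
    fix i assume "i \<in> {..<n}"
    then have "1 / (1 + z i) * (1 / (1 + z i)) \<le> 1 / (1 + z i) * 1"
      using zpos[of i] by (intro mult_left_mono) auto
    then show "1 / (1 + z i) * (1 / (1 + z i)) * p i \<le> 1 / (1 + z i) * p i"
      using p0 \<open>i \<in> {..<n}\<close> by (intro mult_right_mono) auto
  qed
  have gN: "1 - 1 / r \<le> N"
  proof -
    \<comment> \<open>Outcomes with \<open>p i > L * q i\<close> are dropped at a cost of at most
      \<open>1 / r\<close>; on the others \<open>p i = 0\<close> or \<open>z i = 0\<close>, so
      \<open>G\<close> loses nothing there.\<close>
    have "1 - 1 / r \<le> (\<Sum>i<n. p i) - (\<Sum>i\<in>{i. i < n \<and> p i > L * q i}. p i)" using bad p1 by simp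
    also have "\<dots> = (\<Sum>i\<in>{..<n} - {i. i < n \<and> p i > L * q i}. p i)"
      by (subst sum_diff) auto
    also have "\<dots> = (\<Sum>i\<in>{..<n} - {i. i < n \<and> p i > L * q i}. 1 / (1 + z i) * (1 / (1 + z i)) * p i)"
    proof (intro sum.cong refl)
      fix i assume "i \<in> {..<n} - {i. i < n \<and> p i > L * q i}"
      then have i: "i < n" "p i \<le> L * q i" by auto
      show "p i = 1 / (1 + z i) * (1 / (1 + z i)) * p i"
      proof (cases "p i = 0")
        case False
        then have "0 < p i" using p0[OF i(1)] by simp
        then have "z i = 0" using minimizer_zero[OF min[OF E] z i(1)] i(2) by (simp add: p_def q_def)
        then show ?thesis by simp
      qed simp
    qed
    also have "\<dots> \<le> N" unfolding N_def
      using p0 zpos by (intro sum_mono2) (auto intro!: mult_nonneg_nonneg simp: less_imp_le)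
    finally show ?thesis .
  qed
  have "1 / r < 1" using r by simp
  then have N: "N > 0" using gN by linarith
  have trG: "mtrace (\<rho> * G) = complex_of_real a"
    unfolding G_def a_def p_def by (rule hermitian_mtrace_spectral[OF Rc Rh Ec])
  have trGG: "mtrace (\<rho> * (G * G)) = complex_of_real N"
    unfolding G_def N_def p_def spectral_mult[OF E] by (rule hermitian_mtrace_spectral[OF Rc Rh Ec])
  define \<phi> where "\<phi> = complex_of_real (1 / sqrt N) \<cdot>\<^sub>v local_apply n m G \<psi>"
  have \<phi>c: "\<phi> \<in> carrier_vec (n * m)" by (simp add: \<phi>_def)
  have nn: "(1 / sqrt N)\<^sup>2 = 1 / N" using N by (simp add: power_divide)
  have \<phi>p: "ptrace2 n m (proj \<phi>) = complex_of_real (1 / N) \<cdot>\<^sub>m (G * (\<rho> * G))"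
    unfolding \<phi>_def ptrace2_proj_smult[OF local_apply_carrier] nn ptrace2_local_apply[OF G(1) \<psi>c] \<psi>p G(2) ..
  have GRG: "G * (\<rho> * G) \<in> carrier_mat n n" using G Rc by simp
  have "\<phi> \<bullet>c \<phi> = complex_of_real (1 / N) * mtrace (G * (\<rho> * G))"
    unfolding mtrace_ptrace2_proj[OF \<phi>c, symmetric] \<phi>p by (rule mtrace_smult[OF GRG])
  also have "mtrace (G * (\<rho> * G)) = mtrace ((\<rho> * G) * G)" using G Rc by (intro mtrace_comm[of _ n n]) auto
  also have "\<dots> = complex_of_real N" using G Rc trGG by (simp add: assoc_mult_mat[of _ n n _ n _ n])
  also have "complex_of_real (1 / N) * complex_of_real N = 1" using N by simp
  finally have \<phi>1: "\<phi> \<bullet>c \<phi> = 1" .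
  have "\<phi> \<bullet>c \<psi> = complex_of_real (1 / sqrt N) * (local_apply n m G \<psi> \<bullet>c \<psi>)"
    unfolding \<phi>_def using \<psi>c local_apply_carrier[of n m G \<psi>] by simp
  also have "local_apply n m G \<psi> \<bullet>c \<psi> = mtrace (\<rho> * G)"
    unfolding local_apply_cinner[OF G(1) \<psi>c] \<psi>p by (rule mtrace_comm[OF G(1) Rc])
  finally have "\<phi> \<bullet>c \<psi> = complex_of_real (1 / sqrt N * a)" unfolding trG of_real_mult .
  then have "(cmod (\<psi> \<bullet>c \<phi>))\<^sup>2 = (1 / sqrt N * a)\<^sup>2"
    unfolding cinner_cmod_commute[OF \<psi>c \<phi>c] by (simp only: norm_of_real power2_abs)
  \<comment> \<open>\<open>a / N \<ge> 1\<close> because the eigenvalues of \<open>G\<close> are at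
    most 1. So the squared overlap is at least \<open>a\<close>, and
    \<open>a \<ge> N \<ge> 1 - 1 / r\<close>.\<close>
  also have "\<dots> = a * (a / N)" unfolding power_mult_distrib nn by (simp add: power2_eq_square)
  also have "\<dots> \<ge> a * 1" using N Na by (intro mult_left_mono) auto
  finally have ov: "1 - 1 / r \<le> (cmod (\<psi> \<bullet>c \<phi>))\<^sup>2" using gN Na by simp
  have sub: "c * qform (ptrace2 n m (proj \<phi>)) v \<le> qform \<sigma> v" if v: "v \<in> carrier_vec n" for v
  proof -
    have s0: "qform \<sigma> v \<ge> 0" by (rule psd_matD(2)[OF Sp Sc v])
    have "qform (ptrace2 n m (proj \<phi>)) v = 1 / N * qform (G * (\<rho> * G)) v"
      unfolding \<phi>p by (rule qform_smult[OF GRG v])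
    also have "qform (G * (\<rho> * G)) v = qform \<rho> (G *\<^sub>v v)"
      using qform_sandwich[OF G(1) Rc v] unfolding G(2) .
    finally have "c * qform (ptrace2 n m (proj \<phi>)) v = c / N * qform \<rho> (G *\<^sub>v v)" by simp
    also have "\<dots> \<le> c / N * (L * qform \<sigma> v)"
      unfolding G_def using c0 N minimizer_first_order[OF Rc Sc psd_matD(2)[OF Sp Sc] L E z min v]
      by (intro mult_left_mono) auto
    also have "\<dots> = (c * L) / N * qform \<sigma> v" by simp
    also have "\<dots> \<le> 1 * qform \<sigma> v" using s0 N gN cL by (intro mult_right_mono) auto
    finally show ?thesis by simp
  qed
  have "pure_state (n * m) \<phi>" using \<phi>c \<phi>1 by (simp add: pure_state_def)
  then show ?thesis using c0 c1 ov sub by blast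
qed

theorem theorem2:
  fixes n m :: nat and \<rho> \<sigma> :: "complex mat" and r :: real and \<psi> :: "complex vec"
  assumes "m \<ge> n"
    and "density_mat n \<rho>" and "density_mat n \<sigma>"
    and "r > 1"
    and "purification n m \<rho> \<psi>"
  shows "\<exists>\<phi> \<theta> \<zeta>. pure_state (n*m) \<phi> \<and> pure_state (n*m) \<theta> \<and>
           purification n (m*2) \<sigma> \<zeta> \<and>
           trace_norm (proj \<psi> - proj \<phi>) \<le> 2 / sqrt r \<and>
           \<zeta> = complex_of_real (sqrt (zeta_coeff r (rel_entropy \<rho> \<sigma>))) \<cdot>\<^sub>v vec_kron \<phi> (unit_vec 2 1)
             + complex_of_real (sqrt (1 - zeta_coeff r (rel_entropy \<rho> \<sigma>))) \<cdot>\<^sub>v vec_kron \<theta> (unit_vec 2 0)"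
proof -
  let ?c = "zeta_coeff r (rel_entropy \<rho> \<sigma>)"
  have Sc: "\<sigma> \<in> carrier_mat n n" and Rc: "\<rho> \<in> carrier_mat n n" and Sp: "psd_mat \<sigma>"
    using assms by (auto simp: density_mat_def)
  have \<psi>: "pure_state (n * m) \<psi>" using assms(5) by (simp add: purification_def)
  have "0 \<le> ?c \<and> ?c < 1 \<and> (\<exists>\<phi>. pure_state (n * m) \<phi> \<and> 1 - 1 / r \<le> (cmod (\<psi> \<bullet>c \<phi>))\<^sup>2 \<and>
      (\<forall>v \<in> carrier_vec n. ?c * qform (ptrace2 n m (proj \<phi>)) v \<le> qform \<sigma> v))"
  proof (cases "\<forall>v \<in> carrier_vec n. \<sigma> *\<^sub>v v = 0\<^sub>v n \<longrightarrow> \<rho> *\<^sub>v v = 0\<^sub>v n")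
    case True
    have dims: "dim_row \<sigma> = n" "dim_row \<rho> = n" using Sc Rc by auto
    have "?c = (r - 1) / (r * 2 powr (r * kprime (Re (mtrace (\<rho> * (mat_fun log2_supp \<rho> - mat_fun log2_supp \<sigma>))))))"
      using True by (simp add: rel_entropy_def zeta_coeff_def dims)
    then show ?thesis using substate_vector[OF assms(2,3,4,5)] True by simp
  next
    \<comment> \<open>Infinite relative entropy: the coefficient is 0, so \<open>\<psi>\<close>
      itself serves as \<open>\<phi>\<close> with full overlap, and the bound reduces to the
      positivity of \<open>\<sigma>\<close>.\<close>
    case False
    have dims: "dim_row \<sigma> = n" "dim_row \<rho> = n" using Sc Rc by auto
    have "rel_entropy \<rho> \<sigma> = \<infinity>" unfolding rel_entropy_def dims using False by (rule if_not_P)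
    then have "?c = 0" by (simp add: zeta_coeff_def)
    then show ?thesis using \<psi> assms(4) psd_matD(2)[OF Sp Sc]
      by (intro conjI exI[of _ \<psi>]) (auto simp: pure_state_def)
  qed
  then obtain \<phi> where c: "0 \<le> ?c" "?c < 1" and \<phi>: "pure_state (n * m) \<phi>"
    and ov: "1 - 1 / r \<le> (cmod (\<psi> \<bullet>c \<phi>))\<^sup>2"
    and le: "\<And>v. v \<in> carrier_vec n \<Longrightarrow> ?c * qform (ptrace2 n m (proj \<phi>)) v \<le> qform \<sigma> v" by blast
  have "trace_norm (proj \<psi> - proj \<phi>) \<le> 2 * sqrt (1 - (cmod (\<psi> \<bullet>c \<phi>))\<^sup>2)"
    using \<psi> \<phi> by (intro trace_norm_proj_diff_le) (auto simp: pure_state_def)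
  also have "\<dots> \<le> 2 * sqrt (1 / r)" using ov by simp
  finally have "trace_norm (proj \<psi> - proj \<phi>) \<le> 2 / sqrt r" by (simp add: real_sqrt_divide)
  then show ?thesis using flagged_purification[OF assms(3,1) \<phi> c le] \<phi> by blast
qed

end
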